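(* Let $X$ be a closed smooth manifold and let $f:X\to\mathbb{B}^N$ be an immersion with $\mathfrak{c}(f)<\sqrt{\frac{3}{2}}$. Then the induced metric $g=f^*g_{\mathbb{R}^N}$ is conformally equivalent to a metric of positive sectional curvature; that is, there is a smooth function $\psi:X\to\mathbb{R}$ such that $\tilde g=e^{2\psi}g$ has positive sectional curvature.
   Context: $\mathbb{B}^N\subset\mathbb{R}^N$ denotes the closed unit ball. For a smooth immersion $f:X\to\mathbb{B}^N$ with (vector-valued) second fundamental form $\mathbf{A}$ in $\mathbb{R}^N$, the maximal normal curvature is $\mathfrak{c}(f):=\sup_{|u|=1}|\mathbf{A}(u,u)|$, the supremum being over all tangent vectors $u$ to $X$ of unit length with respect to the pullback metric $g=f^*g_{\mathbb{R}^N}$. *)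

theory Defs
  imports "HOL-Analysis.Analysis"
begin

section \<open>Smooth functions on open subsets of Euclidean space\<close>

abbreviation dir_deriv ::
  "('a::real_normed_vector \<Rightarrow> 'b::real_normed_vector) \<Rightarrow> 'a \<Rightarrow> 'a \<Rightarrow> 'b" where
  "dir_deriv F x u \<equiv> frechet_derivative F (at x) u"

text \<open>For an open subset \<open>S\<close> of a finite-dimensional space this is the class \<open>C\<^sup>k\<close>: a function is
  \<open>C\<^sup>k\<^sup>+\<^sup>1\<close> iff it is differentiable and all its directional derivatives are \<open>C\<^sup>k\<close>.\<close>

primrec Ck_on ::
  "nat \<Rightarrow> 'a::euclidean_space set \<Rightarrow> ('a \<Rightarrow> 'b::real_normed_vector) \<Rightarrow> bool" where
  "Ck_on 0 S F \<longleftrightarrow> continuous_on S F"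
| "Ck_on (Suc k) S F \<longleftrightarrow>
     (\<forall>x\<in>S. F differentiable (at x)) \<and> (\<forall>v. Ck_on k S (\<lambda>x. dir_deriv F x v))"

definition smooth_on ::
  "'a::euclidean_space set \<Rightarrow> ('a \<Rightarrow> 'b::real_normed_vector) \<Rightarrow> bool" where
  "smooth_on S F \<longleftrightarrow> (\<forall>k. Ck_on k S F)"


section \<open>Closed smooth manifolds\<close>

text \<open>A chart \<open>(U, \<phi>)\<close> is a coordinate domain together with its coordinate map. Points in a chart
  are usually given below by their coordinate vector \<open>x \<in> \<phi> ` U\<close>, and tangent vectors by their
  coordinate vector with respect to that chart.\<close>

type_synonym ('a, 'm) chart = "'a set \<times> ('a \<Rightarrow> 'm)"

abbreviation chart_dom :: "('a, 'm) chart \<Rightarrow> 'a set" where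
  "chart_dom c \<equiv> fst c"

abbreviation chart_map :: "('a, 'm) chart \<Rightarrow> 'a \<Rightarrow> 'm" where
  "chart_map c \<equiv> snd c"

abbreviation chart_image :: "('a, 'm) chart \<Rightarrow> 'm set" where
  "chart_image c \<equiv> snd c ` fst c"

definition chart_inv :: "('a, 'm) chart \<Rightarrow> 'm \<Rightarrow> 'a" where
  "chart_inv c = inv_into (chart_dom c) (chart_map c)"

definition is_chart :: "'a topology \<Rightarrow> ('a, 'm::euclidean_space) chart \<Rightarrow> bool" where
  "is_chart X c \<longleftrightarrow>
     openin X (chart_dom c) \<and> open (chart_image c) \<and>
     homeomorphic_map (subtopology X (chart_dom c)) (top_of_set (chart_image c)) (chart_map c)"

definition transition ::
  "('a, 'm) chart \<Rightarrow> ('a, 'm) chart \<Rightarrow> 'm::euclidean_space \<Rightarrow> 'm" where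
  "transition c d = chart_map d \<circ> chart_inv c"

definition smooth_atlas ::
  "'a topology \<Rightarrow> ('a, 'm::euclidean_space) chart set \<Rightarrow> bool" where
  "smooth_atlas X A \<longleftrightarrow>
     (\<forall>c\<in>A. is_chart X c) \<and> (\<Union>c\<in>A. chart_dom c) = topspace X \<and>
     (\<forall>c\<in>A. \<forall>d\<in>A. smooth_on (chart_map c ` (chart_dom c \<inter> chart_dom d)) (transition c d))"

text \<open>The atlas \<open>A\<close> need not be maximal. The notions below do not depend on the choice of an atlas
  within a smooth structure.\<close>

definition closed_smooth_manifold ::
  "'a topology \<Rightarrow> ('a, 'm::euclidean_space) chart set \<Rightarrow> bool" where
  "closed_smooth_manifold X A \<longleftrightarrow>
     Hausdorff_space X \<and> second_countable X \<and> compact_space X \<and> smooth_atlas X A"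

abbreviation in_chart :: "('a \<Rightarrow> 'b) \<Rightarrow> ('a, 'm) chart \<Rightarrow> 'm \<Rightarrow> 'b" where
  "in_chart f c \<equiv> f \<circ> chart_inv c"

definition smooth_map ::
  "('a, 'm::euclidean_space) chart set \<Rightarrow> ('a \<Rightarrow> 'b::real_normed_vector) \<Rightarrow> bool" where
  "smooth_map A f \<longleftrightarrow> (\<forall>c\<in>A. smooth_on (chart_image c) (in_chart f c))"

definition immersion ::
  "('a, 'm::euclidean_space) chart set \<Rightarrow> ('a \<Rightarrow> 'b::euclidean_space) \<Rightarrow> bool" where
  "immersion A f \<longleftrightarrow>
     smooth_map A f \<and> (\<forall>c\<in>A. \<forall>x\<in>chart_image c. inj (dir_deriv (in_chart f c) x))"


section \<open>Riemannian metrics and sectional curvature\<close>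

text \<open>A covariant 2-tensor field is given by its coordinate expressions: \<open>g c x u v\<close> is its value at
  the point with coordinates \<open>x\<close> in the chart \<open>c\<close>, on the tangent vectors with coordinates \<open>u\<close>
  and \<open>v\<close>. The last conjunct below is the transformation law under a change of charts.\<close>

type_synonym ('a, 'm) tensor2 = "('a, 'm) chart \<Rightarrow> 'm \<Rightarrow> 'm \<Rightarrow> 'm \<Rightarrow> real"

definition riemannian_metric ::
  "('a, 'm::euclidean_space) chart set \<Rightarrow> ('a, 'm) tensor2 \<Rightarrow> bool" where
  "riemannian_metric A g \<longleftrightarrow>
     (\<forall>c\<in>A. \<forall>u v. smooth_on (chart_image c) (\<lambda>x. g c x u v)) \<and>
     (\<forall>c\<in>A. \<forall>x\<in>chart_image c.
        bilinear (g c x) \<and> (\<forall>u v. g c x u v = g c x v u) \<and> (\<forall>u. u \<noteq> 0 \<longrightarrow> 0 < g c x u u)) \<and>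
     (\<forall>c\<in>A. \<forall>d\<in>A. \<forall>p\<in>chart_dom c \<inter> chart_dom d. \<forall>u v.
        g c (chart_map c p) u v =
        g d (chart_map d p) (dir_deriv (transition c d) (chart_map c p) u)
                            (dir_deriv (transition c d) (chart_map c p) v))"

text \<open>The Christoffel symbols of the Levi-Civita connection as a vector-valued bilinear map:
  \<open>christoffel g c x u v\<close> is the covariant derivative at \<open>x\<close> of the coordinate-constant field \<open>v\<close> in
  direction \<open>u\<close>, characterised by the Koszul formula, where the Lie brackets of the
  coordinate-constant fields \<open>u\<close>, \<open>v\<close>, \<open>z\<close> vanish.\<close>

definition christoffel ::
  "('a, 'm::euclidean_space) tensor2 \<Rightarrow> ('a, 'm) chart \<Rightarrow> 'm \<Rightarrow> 'm \<Rightarrow> 'm \<Rightarrow> 'm" where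
  "christoffel g c x u v =
     (THE w. \<forall>z. 2 * g c x w z =
        dir_deriv (\<lambda>y. g c y v z) x u + dir_deriv (\<lambda>y. g c y u z) x v
        - dir_deriv (\<lambda>y. g c y u v) x z)"

text \<open>The curvature tensor \<open>R(u,v)w = \<nabla>\<^sub>u\<nabla>\<^sub>v w - \<nabla>\<^sub>v\<nabla>\<^sub>u w\<close> for coordinate-constant \<open>u\<close>, \<open>v\<close>, \<open>w\<close>.\<close>

definition curvature_tensor ::
  "('a, 'm::euclidean_space) tensor2 \<Rightarrow> ('a, 'm) chart \<Rightarrow> 'm \<Rightarrow> 'm \<Rightarrow> 'm \<Rightarrow> 'm \<Rightarrow> 'm" where
  "curvature_tensor g c x u v w =
     dir_deriv (\<lambda>y. christoffel g c y v w) x u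
     - dir_deriv (\<lambda>y. christoffel g c y u w) x v
     + christoffel g c x u (christoffel g c x v w)
     - christoffel g c x v (christoffel g c x u w)"

definition sectional_curvature ::
  "('a, 'm::euclidean_space) tensor2 \<Rightarrow> ('a, 'm) chart \<Rightarrow> 'm \<Rightarrow> 'm \<Rightarrow> 'm \<Rightarrow> real" where
  "sectional_curvature g c x u v =
     g c x (curvature_tensor g c x u v v) u / (g c x u u * g c x v v - (g c x u v)\<^sup>2)"

definition positive_sectional_curvature ::
  "('a, 'm::euclidean_space) chart set \<Rightarrow> ('a, 'm) tensor2 \<Rightarrow> bool" where
  "positive_sectional_curvature A g \<longleftrightarrow>
     (\<forall>c\<in>A. \<forall>x\<in>chart_image c. \<forall>u v.
        u \<noteq> v \<and> independent {u, v} \<longrightarrow> 0 < sectional_curvature g c x u v)"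

definition conformal_metric ::
  "('a \<Rightarrow> real) \<Rightarrow> ('a, 'm::euclidean_space) tensor2 \<Rightarrow> ('a, 'm) tensor2" where
  "conformal_metric \<psi> g c x u v = exp (2 * \<psi> (chart_inv c x)) * g c x u v"


section \<open>Geometry of immersions\<close>

definition pullback_metric ::
  "('a \<Rightarrow> 'b::euclidean_space) \<Rightarrow> ('a, 'm::euclidean_space) tensor2" where
  "pullback_metric f c x u v = dir_deriv (in_chart f c) x u \<bullet> dir_deriv (in_chart f c) x v"

text \<open>The component of \<open>w\<close> orthogonal to the subspace \<open>T\<close>.\<close>

definition normal_part :: "'b::euclidean_space set \<Rightarrow> 'b \<Rightarrow> 'b" where
  "normal_part T w = (THE n. n \<in> T\<^sup>\<bottom> \<and> w - n \<in> T)"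

text \<open>The second fundamental form \<open>A(u,v) = (D\<^sub>u (df(v)))\<^sup>\<bottom>\<close>, where \<open>v\<close> is extended to a
  coordinate-constant field and \<open>D\<close> is the flat derivative of the ambient space.\<close>

definition second_fundamental_form ::
  "('a \<Rightarrow> 'b::euclidean_space) \<Rightarrow> ('a, 'm::euclidean_space) chart \<Rightarrow> 'm \<Rightarrow> 'm \<Rightarrow> 'm \<Rightarrow> 'b" where
  "second_fundamental_form f c x u v =
     normal_part (range (dir_deriv (in_chart f c) x))
       (dir_deriv (\<lambda>y. dir_deriv (in_chart f c) y v) x u)"

text \<open>The supremum is taken in the extended reals, so no boundedness is presupposed.\<close>

definition max_normal_curvature ::
  "('a, 'm::euclidean_space) chart set \<Rightarrow> ('a \<Rightarrow> 'b::euclidean_space) \<Rightarrow> ereal" where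
  "max_normal_curvature A f =
     Sup {ereal (norm (second_fundamental_form f c x u u)) | c x u.
            c \<in> A \<and> x \<in> chart_image c \<and> sqrt (pullback_metric f c x u u) = 1}"

end

theory Submission
  imports Defs
begin

text \<open>The conformal factor is \<open>exp (2 \<psi>)\<close> with \<open>\<psi> = - 3 |f|\<^sup>2 / 2\<close>. Write \<open>f = f\<^sup>T + N\<close> for the
  decomposition into tangential and normal part along the immersion.

  \<^item> At a maximum of \<open>|f|\<^sup>2 + 2 |f\<^sup>T|\<^sup>2\<close> the derivative in the direction of \<open>f\<^sup>T\<close> is
    \<open>6 |f\<^sup>T|\<^sup>2 + 4 \<langle>N, A(f\<^sup>T,f\<^sup>T)\<rangle>\<close>. As \<open>|N| \<le> 1\<close> and \<open>|A(u,u)| < 3/2\<close> for unit \<open>u\<close>, it vanishes only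
    if \<open>f\<^sup>T = 0\<close>. Hence \<open>|f|\<^sup>2 + 2 |f\<^sup>T|\<^sup>2 \<le> 1\<close> on all of the manifold.

  \<^item> For a \<open>g\<close>-orthonormal pair \<open>u, v\<close> put \<open>H = (A(u,u) + A(v,v)) / 2\<close>. By the Gauss equation and the
    conformal change formula the new sectional curvature has the sign of
    \<open>\<langle>A(u,u),A(v,v)\<rangle> - |A(u,v)|\<^sup>2 + 6 + 6 \<langle>N,H\<rangle> - 9 |f\<^sup>T|\<^sup>2 + 9 \<langle>f,u\<rangle>\<^sup>2 + 9 \<langle>f,v\<rangle>\<^sup>2\<close>.
    Adding the bounds \<open>|A|\<^sup>2 < 3/2\<close> at \<open>u\<close>, \<open>v\<close> and \<open>(u \<plusminus> v) / \<surd>2\<close> shows that the first two terms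
    exceed \<open>3 |H|\<^sup>2 - 3\<close>, so the sum exceeds \<open>3 |H + N|\<^sup>2 + 3 (1 - |f|\<^sup>2 - 2 |f\<^sup>T|\<^sup>2) \<ge> 0\<close>.\<close>

section \<open>Calculus of \<open>C\<^sup>k\<close> functions\<close>

lemma dir_deriv_eqI: "(F has_derivative F') (at x) \<Longrightarrow> dir_deriv F x u = F' u"
  using frechet_derivative_at by metis

lemma dir_deriv_cong:
  assumes "open S" "x \<in> S" "\<And>y. y \<in> S \<Longrightarrow> F y = G y"
  shows "dir_deriv F x = dir_deriv G x"
proof -
  have "(F has_derivative D) (at x) \<longleftrightarrow> (G has_derivative D) (at x)" for D
    using has_derivative_transform_within_open[of _ D x UNIV S] assms by metis
  then show ?thesis
    unfolding frechet_derivative_def by simp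
qed

lemma differentiable_cong:
  assumes "open S" "x \<in> S" "\<And>y. y \<in> S \<Longrightarrow> F y = G y" "F differentiable at x"
  shows "G differentiable at x"
  using assms has_derivative_transform_within_open[of F _ x UNIV S G]
  unfolding differentiable_def by blast

lemma Ck_on_cong:
  assumes "open S" "Ck_on k S F" "\<And>y. y \<in> S \<Longrightarrow> F y = G y"
  shows "Ck_on k S G"
  using assms(2,3)
proof (induction k arbitrary: F G)
  case 0
  then show ?case by (simp cong: continuous_on_cong)
next
  case (Suc k)
  have "Ck_on k S (\<lambda>x. dir_deriv G x v)" for v
  proof (rule Suc.IH[where F = "\<lambda>x. dir_deriv F x v"])
    show "Ck_on k S (\<lambda>x. dir_deriv F x v)"
      using Suc.prems(1) by simp
    show "dir_deriv F y v = dir_deriv G y v" if "y \<in> S" for y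
      using dir_deriv_cong[OF \<open>open S\<close> that Suc.prems(2)] by simp
  qed
  moreover have "\<forall>x\<in>S. G differentiable (at x)"
    using Suc.prems differentiable_cong[OF \<open>open S\<close>] by (metis Ck_on.simps(2))
  ultimately show ?case by simp
qed

lemma Ck_on_SucD: "Ck_on (Suc k) S F \<Longrightarrow> Ck_on k S F"
proof (induction k arbitrary: F)
  case 0
  then show ?case
    by (auto intro!: continuous_at_imp_continuous_on differentiable_imp_continuous_within)
qed auto

lemma Ck_on_const: "Ck_on k S (\<lambda>x. c)"
  by (induction k arbitrary: c) auto

lemma Ck_on_add:
  assumes "open S" "Ck_on k S F" "Ck_on k S G"
  shows "Ck_on k S (\<lambda>x. F x + G x)"
  using assms(2,3)
proof (induction k arbitrary: F G)
  case 0
  then show ?case by (auto intro: continuous_intros)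
next
  case (Suc k)
  have "Ck_on k S (\<lambda>x. dir_deriv (\<lambda>x. F x + G x) x v)" for v
  proof (rule Ck_on_cong[OF \<open>open S\<close>, where F = "\<lambda>x. dir_deriv F x v + dir_deriv G x v"])
    show "Ck_on k S (\<lambda>x. dir_deriv F x v + dir_deriv G x v)"
      using Suc by simp
    fix y assume "y \<in> S"
    then show "dir_deriv F y v + dir_deriv G y v = dir_deriv (\<lambda>x. F x + G x) y v"
      using Suc.prems
      by (intro dir_deriv_eqI[symmetric] has_derivative_add)
         (auto simp: frechet_derivative_works[symmetric])
  qed
  then show ?case using Suc.prems by auto
qed

lemma (in bounded_bilinear) Ck_on:
  fixes F :: "'m::euclidean_space \<Rightarrow> 'a" and G :: "'m \<Rightarrow> 'b"
  assumes "open S" "Ck_on k S F" "Ck_on k S G"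
  shows "Ck_on k S (\<lambda>x. F x ** G x)"
  using assms(2,3)
proof (induction k arbitrary: F G)
  case 0
  then show ?case by (auto intro: continuous_on)
next
  case (Suc k)
  have diff: "(F has_derivative dir_deriv F x) (at x)" "(G has_derivative dir_deriv G x) (at x)"
    if "x \<in> S" for x
    using Suc.prems that by (auto simp: frechet_derivative_works[symmetric])
  have "Ck_on k S (\<lambda>x. dir_deriv (\<lambda>x. F x ** G x) x v)" for v
  proof (rule Ck_on_cong[OF \<open>open S\<close>])
    show "Ck_on k S (\<lambda>x. F x ** dir_deriv G x v + dir_deriv F x v ** G x)"
      using Suc Ck_on_SucD[OF Suc.prems(1)] Ck_on_SucD[OF Suc.prems(2)]
      by (intro Ck_on_add \<open>open S\<close>) auto
    fix y assume "y \<in> S"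
    then show "F y ** dir_deriv G y v + dir_deriv F y v ** G y = dir_deriv (\<lambda>x. F x ** G x) y v"
      by (intro dir_deriv_eqI[symmetric] FDERIV) (rule diff; simp)+
  qed
  moreover have "\<forall>x\<in>S. (\<lambda>x. F x ** G x) differentiable (at x)"
    using FDERIV[OF diff] by (auto simp: differentiable_def)
  ultimately show ?case by simp
qed

lemma Ck_on_exp:
  fixes h :: "'m::euclidean_space \<Rightarrow> real"
  assumes "open S" "Ck_on k S h"
  shows "Ck_on k S (\<lambda>x. exp (h x))"
  using assms(2)
proof (induction k)
  case 0
  then show ?case by (auto intro: continuous_intros)
next
  case (Suc k)
  have deriv: "((\<lambda>x. exp (h x)) has_derivative (\<lambda>v. exp (h x) * dir_deriv h x v)) (at x)"
    if "x \<in> S" for x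
  proof -
    have "(h has_derivative dir_deriv h x) (at x)"
      using Suc.prems that by (auto simp: frechet_derivative_works[symmetric])
    then show ?thesis
      by (auto intro!: derivative_eq_intros simp: mult.commute)
  qed
  have "Ck_on k S (\<lambda>x. dir_deriv (\<lambda>x. exp (h x)) x v)" for v
  proof (rule Ck_on_cong[OF \<open>open S\<close>])
    show "Ck_on k S (\<lambda>x. exp (h x) * dir_deriv h x v)"
      using Suc Ck_on_SucD[OF Suc.prems]
      by (intro bounded_bilinear.Ck_on[OF bounded_bilinear_mult] \<open>open S\<close>) auto
  qed (use dir_deriv_eqI[OF deriv] in auto)
  then show ?case
    using deriv by (auto simp: differentiable_def)
qed

lemma smooth_on_const: "smooth_on S (\<lambda>x. c)"
  by (simp add: smooth_on_def Ck_on_const)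

lemma smooth_on_add:
  "open S \<Longrightarrow> smooth_on S F \<Longrightarrow> smooth_on S G \<Longrightarrow> smooth_on S (\<lambda>x. F x + G x)"
  by (simp add: smooth_on_def Ck_on_add)

lemma smooth_on_mult:
  fixes F G :: "'m::euclidean_space \<Rightarrow> real"
  shows "open S \<Longrightarrow> smooth_on S F \<Longrightarrow> smooth_on S G \<Longrightarrow> smooth_on S (\<lambda>x. F x * G x)"
  by (simp add: smooth_on_def bounded_bilinear.Ck_on[OF bounded_bilinear_mult])

lemma smooth_on_inner:
  fixes F G :: "'m::euclidean_space \<Rightarrow> 'b::real_inner"
  shows "open S \<Longrightarrow> smooth_on S F \<Longrightarrow> smooth_on S G \<Longrightarrow> smooth_on S (\<lambda>x. F x \<bullet> G x)"
  by (simp add: smooth_on_def bounded_bilinear.Ck_on[OF bounded_bilinear_inner])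

lemma smooth_on_exp:
  fixes h :: "'m::euclidean_space \<Rightarrow> real"
  shows "open S \<Longrightarrow> smooth_on S h \<Longrightarrow> smooth_on S (\<lambda>x. exp (h x))"
  by (simp add: smooth_on_def Ck_on_exp)

lemma smooth_on_dir_deriv: "smooth_on S F \<Longrightarrow> smooth_on S (\<lambda>x. dir_deriv F x v)"
  unfolding smooth_on_def using Ck_on.simps(2) by blast

lemma smooth_on_has_derivative:
  "smooth_on S F \<Longrightarrow> x \<in> S \<Longrightarrow> (F has_derivative dir_deriv F x) (at x)"
  unfolding smooth_on_def frechet_derivative_works[symmetric] using Ck_on.simps(2) by blast

lemma smooth_on_linear_dir_deriv: "smooth_on S F \<Longrightarrow> x \<in> S \<Longrightarrow> linear (dir_deriv F x)"
  using smooth_on_has_derivative has_derivative_linear by blast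

lemma smooth_on_imp_continuous_on: "smooth_on S F \<Longrightarrow> continuous_on S F"
  unfolding smooth_on_def using Ck_on.simps(1) by blast

text \<open>The left-hand side is symmetric in \<open>u\<close> and \<open>v\<close>, whence the symmetry of second derivatives.\<close>

lemma second_difference_mvt:
  fixes F :: "'m::euclidean_space \<Rightarrow> real"
  assumes S: "ball x r \<subseteq> S" "0 < h" "h * (norm u + norm v) < r"
    and F: "\<And>y. y \<in> S \<Longrightarrow> (F has_derivative dir_deriv F y) (at y)"
    and DF: "\<And>y. y \<in> S \<Longrightarrow>
      ((\<lambda>y. dir_deriv F y u) has_derivative dir_deriv (\<lambda>y. dir_deriv F y u) y) (at y)"
  shows "\<exists>y\<in>ball x r. F (x + h *\<^sub>R u + h *\<^sub>R v) - F (x + h *\<^sub>R u) - F (x + h *\<^sub>R v) + F x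
    = h\<^sup>2 * dir_deriv (\<lambda>y. dir_deriv F y u) y v"
proof -
  have mem: "x + s *\<^sub>R u + t *\<^sub>R v \<in> ball x r" if "0 \<le> s" "s \<le> h" "0 \<le> t" "t \<le> h" for s t
  proof -
    have "dist x (x + s *\<^sub>R u + t *\<^sub>R v) = norm (s *\<^sub>R u + t *\<^sub>R v)"
      by (metis add.assoc add_diff_cancel_left' dist_commute dist_norm)
    also have "\<dots> \<le> s * norm u + t * norm v"
      using that by (metis abs_of_nonneg norm_scaleR norm_triangle_ineq)
    also have "\<dots> \<le> h * norm u + h * norm v"
      using that by (intro add_mono mult_right_mono) auto
    finally show ?thesis using S by (simp add: algebra_simps)
  qed
  have lin: "linear (dir_deriv F y)" "linear (dir_deriv (\<lambda>y. dir_deriv F y u) y)" if "y \<in> S" for y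
    using F DF that has_derivative_linear by blast+
  define \<phi> where "\<phi> s = F (x + s *\<^sub>R u + h *\<^sub>R v) - F (x + s *\<^sub>R u + 0 *\<^sub>R v)" for s
  have d1: "((\<lambda>s. F (x + s *\<^sub>R u + t *\<^sub>R v)) has_derivative
       (\<lambda>c. c * dir_deriv F (x + s *\<^sub>R u + t *\<^sub>R v) u)) (at s)"
    if "0 \<le> s" "s \<le> h" "0 \<le> t" "t \<le> h" for s t
  proof -
    have "((\<lambda>s. F (x + s *\<^sub>R u + t *\<^sub>R v)) has_derivative
       (\<lambda>c. dir_deriv F (x + s *\<^sub>R u + t *\<^sub>R v) (c *\<^sub>R u))) (at s)"
      using mem[OF that] S(1) by (auto intro!: derivative_eq_intros has_derivative_compose[OF _ F])
    then show ?thesis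
      using lin(1) mem[OF that] S(1) by (auto simp: linear_cmul)
  qed
  have "\<exists>\<xi>>0. \<xi> < h \<and> \<phi> h - \<phi> 0 = (h - 0) * (dir_deriv F (x + \<xi> *\<^sub>R u + h *\<^sub>R v) u - dir_deriv F (x + \<xi> *\<^sub>R u + 0 *\<^sub>R v) u)"
  proof (rule MVT2[OF \<open>0 < h\<close>])
    fix s assume "0 \<le> s" "s \<le> h"
    then show "DERIV \<phi> s :> dir_deriv F (x + s *\<^sub>R u + h *\<^sub>R v) u - dir_deriv F (x + s *\<^sub>R u + 0 *\<^sub>R v) u"
      unfolding \<phi>_def has_field_derivative_def using \<open>0 < h\<close>
      by (intro has_derivative_eq_rhs[OF has_derivative_diff[OF d1[of s h] d1[of s 0]]])
         (auto simp: fun_eq_iff algebra_simps)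
  qed
  then obtain \<xi> where \<xi>: "0 < \<xi>" "\<xi> < h" and
    1: "\<phi> h - \<phi> 0 = h * (dir_deriv F (x + \<xi> *\<^sub>R u + h *\<^sub>R v) u - dir_deriv F (x + \<xi> *\<^sub>R u + 0 *\<^sub>R v) u)"
    by auto
  have "\<exists>\<eta>>0. \<eta> < h \<and> dir_deriv F (x + \<xi> *\<^sub>R u + h *\<^sub>R v) u - dir_deriv F (x + \<xi> *\<^sub>R u + 0 *\<^sub>R v) u
     = (h - 0) * dir_deriv (\<lambda>y. dir_deriv F y u) (x + \<xi> *\<^sub>R u + \<eta> *\<^sub>R v) v"
  proof (rule MVT2[OF \<open>0 < h\<close>])
    fix t assume t: "0 \<le> t" "t \<le> h"
    then have m: "x + \<xi> *\<^sub>R u + t *\<^sub>R v \<in> S"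
      using mem[of \<xi> t] \<xi> S by auto
    have "((\<lambda>t. dir_deriv F (x + \<xi> *\<^sub>R u + t *\<^sub>R v) u) has_derivative
       (\<lambda>c. dir_deriv (\<lambda>y. dir_deriv F y u) (x + \<xi> *\<^sub>R u + t *\<^sub>R v) (c *\<^sub>R v))) (at t)"
    proof (rule has_derivative_compose[where g = "\<lambda>y. dir_deriv F y u"])
      show "((\<lambda>t. x + \<xi> *\<^sub>R u + t *\<^sub>R v) has_derivative (\<lambda>c. c *\<^sub>R v)) (at t)"
        by (auto intro!: derivative_eq_intros)
    qed (rule DF[OF m])
    then show "DERIV (\<lambda>t. dir_deriv F (x + \<xi> *\<^sub>R u + t *\<^sub>R v) u) t :>
        dir_deriv (\<lambda>y. dir_deriv F y u) (x + \<xi> *\<^sub>R u + t *\<^sub>R v) v"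
      unfolding has_field_derivative_def using lin(2)[OF m]
      by (simp add: linear_cmul mult_commute_abs)
  qed
  then obtain \<eta> where \<eta>: "0 < \<eta>" "\<eta> < h" and
    2: "dir_deriv F (x + \<xi> *\<^sub>R u + h *\<^sub>R v) u - dir_deriv F (x + \<xi> *\<^sub>R u + 0 *\<^sub>R v) u
     = h * dir_deriv (\<lambda>y. dir_deriv F y u) (x + \<xi> *\<^sub>R u + \<eta> *\<^sub>R v) v"
    by auto
  show ?thesis
  proof (rule bexI)
    show "x + \<xi> *\<^sub>R u + \<eta> *\<^sub>R v \<in> ball x r"
      using mem[of \<xi> \<eta>] \<xi> \<eta> by auto
    show "F (x + h *\<^sub>R u + h *\<^sub>R v) - F (x + h *\<^sub>R u) - F (x + h *\<^sub>R v) + F x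
    = h\<^sup>2 * dir_deriv (\<lambda>y. dir_deriv F y u) (x + \<xi> *\<^sub>R u + \<eta> *\<^sub>R v) v"
      using 1 2 by (simp add: \<phi>_def power2_eq_square)
  qed
qed

lemma mixed_partials_real:
  fixes F :: "'m::euclidean_space \<Rightarrow> real"
  assumes "open S" "x \<in> S" "smooth_on S F"
  shows "dir_deriv (\<lambda>y. dir_deriv F y u) x v = dir_deriv (\<lambda>y. dir_deriv F y v) x u"
proof (rule ccontr)
  let ?p = "\<lambda>y. dir_deriv (\<lambda>y. dir_deriv F y u) y v"
  let ?q = "\<lambda>y. dir_deriv (\<lambda>y. dir_deriv F y v) y u"
  assume ne: "?p x \<noteq> ?q x"
  define e where "e = dist (?p x) (?q x) / 2"
  have "e > 0" using ne by (simp add: e_def)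
  have "isCont ?p x" "isCont ?q x"
    using assms smooth_on_imp_continuous_on[OF smooth_on_dir_deriv[OF smooth_on_dir_deriv[OF assms(3)]]]
    by (simp_all add: continuous_on_eq_continuous_at)
  then obtain d1 d2 where d: "d1 > 0" "d2 > 0"
     "\<And>y. dist y x < d1 \<Longrightarrow> dist (?p y) (?p x) < e"
     "\<And>y. dist y x < d2 \<Longrightarrow> dist (?q y) (?q x) < e"
    unfolding continuous_at_eps_delta using \<open>e > 0\<close> by blast
  obtain r0 where r0: "r0 > 0" "ball x r0 \<subseteq> S"
    using assms open_contains_ball by blast
  define r where "r = Min {r0, d1, d2}"
  have r: "r > 0" "r \<le> r0" "r \<le> d1" "r \<le> d2"
    using d r0 by (auto simp: r_def)
  have rS: "ball x r \<subseteq> S" using r r0 by auto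
  define h where "h = r / (2 * (norm u + norm v + 1))"
  have pos: "norm u + norm v + 1 > 0"
    by (smt (verit) norm_ge_zero)
  have h: "h > 0" using r pos by (simp add: h_def)
  have "h * (norm u + norm v) < h * (2 * (norm u + norm v + 1))"
    using h pos by (intro mult_strict_left_mono) auto
  also have "\<dots> = r" using pos by (simp add: h_def)
  finally have hr: "h * (norm u + norm v) < r" .
  note dd = smooth_on_has_derivative[OF assms(3)]
    smooth_on_has_derivative[OF smooth_on_dir_deriv[OF assms(3)]]
  obtain y where y: "y \<in> ball x r" "F (x + h *\<^sub>R u + h *\<^sub>R v) - F (x + h *\<^sub>R u) - F (x + h *\<^sub>R v) + F x
    = h\<^sup>2 * ?p y"
    using second_difference_mvt[OF rS h hr dd] by blast
  obtain z where z: "z \<in> ball x r" "F (x + h *\<^sub>R v + h *\<^sub>R u) - F (x + h *\<^sub>R v) - F (x + h *\<^sub>R u) + F x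
    = h\<^sup>2 * ?q z"
    using second_difference_mvt[OF rS h _ dd, of v u] hr by (metis add.commute)
  have "h\<^sup>2 * ?p y = h\<^sup>2 * ?q z"
    using y z by (simp add: algebra_simps)
  then have "?p y = ?q z" using h by simp
  moreover have "dist (?p y) (?p x) < e" "dist (?q z) (?q x) < e"
    using d(3)[of y] d(4)[of z] y z r by (auto simp: dist_commute)
  ultimately show False
    unfolding e_def dist_real_def by (auto simp: abs_if split: if_splits)
qed

lemma mixed_partials:
  fixes F :: "'m::euclidean_space \<Rightarrow> 'n::euclidean_space"
  assumes "open S" "x \<in> S" "smooth_on S F"
  shows "dir_deriv (\<lambda>y. dir_deriv F y u) x v = dir_deriv (\<lambda>y. dir_deriv F y v) x u"
proof (rule euclidean_eqI)
  fix b :: 'n assume "b \<in> Basis"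
  have comp: "dir_deriv (\<lambda>y. G y \<bullet> b) y w = dir_deriv G y w \<bullet> b" if "y \<in> S" "smooth_on S G" for y w and G :: "'m \<Rightarrow> 'n"
    using smooth_on_has_derivative[OF that(2,1)]
    by (intro dir_deriv_eqI has_derivative_inner_left)
  have "dir_deriv (\<lambda>y. dir_deriv F y w) x w' \<bullet> b = dir_deriv (\<lambda>y. dir_deriv (\<lambda>y. F y \<bullet> b) y w) x w'" for w w'
  proof -
    have "dir_deriv (\<lambda>y. dir_deriv F y w) x w' \<bullet> b = dir_deriv (\<lambda>y. dir_deriv F y w \<bullet> b) x w'"
      using comp[OF assms(2) smooth_on_dir_deriv[OF assms(3)]] by simp
    also have "\<dots> = dir_deriv (\<lambda>y. dir_deriv (\<lambda>y. F y \<bullet> b) y w) x w'"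
      using comp[OF _ assms(3)] dir_deriv_cong[OF assms(1,2), of "\<lambda>y. dir_deriv F y w \<bullet> b" "\<lambda>y. dir_deriv (\<lambda>y. F y \<bullet> b) y w"] by simp
    finally show ?thesis .
  qed
  moreover have "smooth_on S (\<lambda>y. F y \<bullet> b)"
    using assms smooth_on_inner smooth_on_const by blast
  ultimately show "dir_deriv (\<lambda>y. dir_deriv F y u) x v \<bullet> b = dir_deriv (\<lambda>y. dir_deriv F y v) x u \<bullet> b"
    using mixed_partials_real[OF assms(1,2)] by simp
qed

section \<open>The curvature tensor in terms of lowered Christoffel symbols\<close>

definition lower :: "('m::euclidean_space \<Rightarrow> 'm \<Rightarrow> real) \<Rightarrow> 'm \<Rightarrow> 'm" where
  "lower g a = (\<Sum>b\<in>Basis. g a b *\<^sub>R b)"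

lemma inner_lower:
  assumes "bilinear g"
  shows "lower g a \<bullet> z = g a z"
proof -
  have lin: "linear (g a)" using assms by (simp add: bilinear_def)
  have "g a z = g a (\<Sum>b\<in>Basis. (z \<bullet> b) *\<^sub>R b)"
    by (simp add: euclidean_representation)
  also have "\<dots> = (\<Sum>b\<in>Basis. (z \<bullet> b) * g a b)"
    using lin by (simp add: linear_sum linear_cmul)
  also have "\<dots> = lower g a \<bullet> z"
    by (simp add: lower_def inner_sum_right inner_commute[of _ z] mult.commute)
  finally show ?thesis by simp
qed

lemma linear_lower:
  assumes "bilinear g"
  shows "linear (lower g)"
  unfolding lower_def using assms
  by (intro linearI)
     (simp_all add: bilinear_ladd bilinear_lmul scaleR_left_distrib sum.distrib scaleR_sum_right)

lemma bij_lower: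
  fixes g :: "'m::euclidean_space \<Rightarrow> 'm \<Rightarrow> real"
  assumes "bilinear g" and pos: "\<And>u. u \<noteq> 0 \<Longrightarrow> 0 < g u u"
  shows "bij (lower g)"
proof -
  have "lower g u = 0 \<Longrightarrow> u = 0" for u
    using inner_lower[OF assms(1), of u u] pos[of u] by auto
  then have "inj (lower g)"
    using linear_lower[OF assms(1)] linear_injective_0 by blast
  then show ?thesis
    using linear_lower[OF assms(1)] linear_injective_imp_surjective by (auto simp: bij_def)
qed

lemma bilinear_riesz:
  fixes g :: "'m::euclidean_space \<Rightarrow> 'm \<Rightarrow> real"
  assumes "bilinear g" "\<And>u. u \<noteq> 0 \<Longrightarrow> 0 < g u u" "linear L"
  shows "\<exists>!w. \<forall>z. g w z = L z"
proof -
  define l where "l = (\<Sum>b\<in>Basis. L b *\<^sub>R b)"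
  have "L z = l \<bullet> z" for z
  proof -
    have "L z = L (\<Sum>b\<in>Basis. (z \<bullet> b) *\<^sub>R b)"
      by (simp add: euclidean_representation)
    also have "\<dots> = l \<bullet> z"
      using assms(3)
      by (simp add: linear_sum linear_cmul l_def inner_sum_right inner_commute[of _ z] mult.commute)
    finally show ?thesis .
  qed
  then have "(\<forall>z. g w z = L z) \<longleftrightarrow> lower g w = l" for w
    using inner_lower[OF assms(1)] by (metis vector_eq_rdot)
  then show ?thesis
    using bij_lower[OF assms(1,2)] by (simp add: bij_iff)
qed

locale coordinate_metric =
  fixes S :: "'m::euclidean_space set" and g :: "'m \<Rightarrow> 'm \<Rightarrow> 'm \<Rightarrow> real"
  assumes open_S: "open S"
    and bilinear: "x \<in> S \<Longrightarrow> bilinear (g x)"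
    and sym: "x \<in> S \<Longrightarrow> g x u v = g x v u"
    and pos: "x \<in> S \<Longrightarrow> u \<noteq> 0 \<Longrightarrow> 0 < g x u u"
    and smooth: "smooth_on S (\<lambda>x. g x u v)"
begin

lemmas has_derivative_metric = smooth_on_has_derivative[OF smooth]

lemma expand_left: "x \<in> S \<Longrightarrow> g x a z = (\<Sum>c\<in>Basis. (a \<bullet> c) * g x c z)"
proof -
  assume "x \<in> S"
  then have lin: "linear (\<lambda>a. g x a z)" using bilinear by (simp add: bilinear_def)
  have "g x (\<Sum>c\<in>Basis. (a \<bullet> c) *\<^sub>R c) z = (\<Sum>c\<in>Basis. (a \<bullet> c) * g x c z)"
    using linear_sum[OF lin, of "\<lambda>c. (a \<bullet> c) *\<^sub>R c" Basis] linear_cmul[OF lin] by simp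
  then show ?thesis by (simp add: euclidean_representation)
qed

lemma has_derivative_along_field:
  assumes "x \<in> S" "(w has_derivative w') (at x)"
  shows "((\<lambda>y. g y (w y) z) has_derivative
    (\<lambda>h. dir_deriv (\<lambda>y. g y (w x) z) x h + g x (w' h) z)) (at x)"
proof -
  have *: "((\<lambda>y. g y (w y) z) has_derivative
    (\<lambda>h. (\<Sum>c\<in>Basis. (w x \<bullet> c) * dir_deriv (\<lambda>y. g y c z) x h + (w' h \<bullet> c) * g x c z))) (at x)"
    if "(w has_derivative w') (at x)" for w w'
  proof (rule has_derivative_transform_within_open[OF _ open_S assms(1)])
    show "((\<lambda>y. \<Sum>c\<in>Basis. (w y \<bullet> c) * g y c z) has_derivative
      (\<lambda>h. (\<Sum>c\<in>Basis. (w x \<bullet> c) * dir_deriv (\<lambda>y. g y c z) x h + (w' h \<bullet> c) * g x c z))) (at x)"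
      by (intro has_derivative_sum has_derivative_mult has_derivative_inner_left that
          has_derivative_metric assms(1))
  qed (simp add: expand_left[symmetric])
  have "dir_deriv (\<lambda>y. g y (w x) z) x h = (\<Sum>c\<in>Basis. (w x \<bullet> c) * dir_deriv (\<lambda>y. g y c z) x h)" for h
    using dir_deriv_eqI[OF *[of "\<lambda>_. w x" "\<lambda>_. 0", OF has_derivative_const]] by simp
  then show ?thesis
    using *[OF assms(2)] expand_left[OF assms(1), of "w' h" for h] by (simp add: sum.distrib)
qed

lemma differentiable_solution:
  assumes x: "x \<in> S"
    and w: "\<And>y z. y \<in> S \<Longrightarrow> g y (w y) z = L y z"
    and L: "\<And>z. (\<lambda>y. L y z) differentiable at x"
  shows "w differentiable at x"
proof -
  define \<Phi> where "\<Phi> p = (fst p, lower (g (fst p)) (snd p))" for p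
  define \<Psi> where "\<Psi> p = (fst p, inv (lower (g (fst p))) (snd p))" for p
  define M where "M h = (\<Sum>b\<in>Basis. dir_deriv (\<lambda>y. g y (w x) b) x h *\<^sub>R b)" for h
  have der: "(\<Phi> has_derivative
      (\<lambda>q. (fst q, \<Sum>b\<in>Basis. (\<Sum>c\<in>Basis. (snd p \<bullet> c) * dir_deriv (\<lambda>y. g y c b) (fst p) (fst q)
         + (snd q \<bullet> c) * g (fst p) c b) *\<^sub>R b))) (at p)" if "p \<in> S \<times> UNIV" for p
  proof (rule has_derivative_transform_within_open[where s = "S \<times> UNIV"])
    have "((\<lambda>p. g (fst p) c b) has_derivative (\<lambda>q. dir_deriv (\<lambda>y. g y c b) (fst p) (fst q))) (at p)" for c b
      by (rule has_derivative_compose[where g = "\<lambda>y. g y c b"])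
         (use that in \<open>auto intro!: has_derivative_metric has_derivative_fst\<close>)
    then show "((\<lambda>p. (fst p, \<Sum>b\<in>Basis. (\<Sum>c\<in>Basis. (snd p \<bullet> c) * g (fst p) c b) *\<^sub>R b)) has_derivative
      (\<lambda>q. (fst q, \<Sum>b\<in>Basis. (\<Sum>c\<in>Basis. (snd p \<bullet> c) * dir_deriv (\<lambda>y. g y c b) (fst p) (fst q)
         + (snd q \<bullet> c) * g (fst p) c b) *\<^sub>R b))) (at p)"
      by (intro has_derivative_Pair has_derivative_sum has_derivative_scaleR_left has_derivative_mult
          has_derivative_inner_left has_derivative_fst has_derivative_snd has_derivative_ident)
  next
    show "open (S \<times> (UNIV :: 'm set))" using open_S by (simp add: open_Times)
  qed (use that in \<open>auto simp: \<Phi>_def lower_def expand_left[symmetric]\<close>)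
  have "(\<Psi> has_derivative (\<lambda>q. (fst q, inv (lower (g x)) (snd q - M (fst q))))) (at (\<Phi> (x, w x)))"
  proof (rule has_derivative_inverse_strong[where S = "S \<times> UNIV" and f = \<Phi> and x = "(x, w x)"])
    show "open (S \<times> (UNIV :: 'm set))" using open_S by (simp add: open_Times)
    show "(x, w x) \<in> S \<times> UNIV" using x by simp
    show "continuous_on (S \<times> UNIV) \<Phi>"
      using der by (meson continuous_at_imp_continuous_on has_derivative_continuous)
    show "\<Psi> (\<Phi> p) = p" if "p \<in> S \<times> UNIV" for p
      using that bij_lower[OF bilinear pos]
      by (auto simp: \<Phi>_def \<Psi>_def bij_def)
    show "(\<Phi> has_derivative (\<lambda>q. (fst q, M (fst q) + lower (g x) (snd q)))) (at (x, w x))"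
    proof (rule has_derivative_eq_rhs[OF der])
      have "dir_deriv (\<lambda>y. g y (w x) b) x h = (\<Sum>c\<in>Basis. (w x \<bullet> c) * dir_deriv (\<lambda>y. g y c b) x h)"
        for b h
      proof (rule dir_deriv_eqI, rule has_derivative_transform_within_open[OF _ open_S x])
        show "((\<lambda>y. \<Sum>c\<in>Basis. (w x \<bullet> c) * g y c b) has_derivative
          (\<lambda>h. \<Sum>c\<in>Basis. (w x \<bullet> c) * dir_deriv (\<lambda>y. g y c b) x h)) (at x)"
          by (intro has_derivative_sum has_derivative_mult_right has_derivative_metric x)
      qed (simp add: expand_left[symmetric])
      then show "(\<lambda>q. (fst q, \<Sum>b\<in>Basis. (\<Sum>c\<in>Basis. (snd (x, w x) \<bullet> c) * dir_deriv (\<lambda>y. g y c b) (fst (x, w x)) (fst q)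
         + (snd q \<bullet> c) * g (fst (x, w x)) c b) *\<^sub>R b)) = (\<lambda>q. (fst q, M (fst q) + lower (g x) (snd q)))"
        using x by (auto simp: fun_eq_iff M_def lower_def sum.distrib scaleR_left_distrib expand_left[OF x, symmetric])
    qed (use x in simp)
    have "lower (g x) (inv (lower (g x)) l) = l" for l
      using bij_lower[OF bilinear[OF x] pos[OF x]] by (simp add: bij_def surj_f_inv_f)
    then show "(\<lambda>q. (fst q, M (fst q) + lower (g x) (snd q))) \<circ>
        (\<lambda>q. (fst q, inv (lower (g x)) (snd q - M (fst q)))) = id"
      by (auto simp: fun_eq_iff)
  qed
  then have "\<Psi> differentiable at (\<Phi> (x, w x))"
    unfolding differentiable_def by blast
  moreover have "(\<lambda>y. (y, \<Sum>b\<in>Basis. L y b *\<^sub>R b)) differentiable at x"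
  proof -
    have "((\<lambda>y. (y, \<Sum>b\<in>Basis. L y b *\<^sub>R b)) has_derivative
        (\<lambda>h. (h, \<Sum>b\<in>Basis. dir_deriv (\<lambda>y. L y b) x h *\<^sub>R b))) (at x)"
      using L by (intro has_derivative_Pair has_derivative_sum has_derivative_scaleR_left
          has_derivative_ident) (simp add: frechet_derivative_works[symmetric])
    then show ?thesis unfolding differentiable_def by blast
  qed
  moreover have "(x, \<Sum>b\<in>Basis. L x b *\<^sub>R b) = \<Phi> (x, w x)"
    using w[OF x] by (simp add: \<Phi>_def lower_def)
  ultimately have "(\<Psi> \<circ> (\<lambda>y. (y, \<Sum>b\<in>Basis. L y b *\<^sub>R b))) differentiable at x"
    by (intro differentiable_chain_at) auto
  then have d: "(\<lambda>y. snd (\<Psi> (y, \<Sum>b\<in>Basis. L y b *\<^sub>R b))) differentiable at x"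
    unfolding differentiable_def o_def using has_derivative_snd by blast
  have "snd (\<Psi> (y, \<Sum>b\<in>Basis. L y b *\<^sub>R b)) = w y" if "y \<in> S" for y
  proof -
    have "(\<Sum>b\<in>Basis. L y b *\<^sub>R b) = lower (g y) (w y)"
      using w[OF that] by (simp add: lower_def)
    then show ?thesis
      using bij_lower[OF bilinear[OF that] pos[OF that]] by (simp add: \<Psi>_def bij_def)
  qed
  then show ?thesis
    using differentiable_cong[OF open_S x _ d] by simp
qed

definition koszul :: "'m \<Rightarrow> 'm \<Rightarrow> 'm \<Rightarrow> 'm \<Rightarrow> real" where
  "koszul x u v z = (dir_deriv (\<lambda>y. g y v z) x u + dir_deriv (\<lambda>y. g y u z) x v
     - dir_deriv (\<lambda>y. g y u v) x z) / 2"

lemma dir_deriv_sym: "x \<in> S \<Longrightarrow> dir_deriv (\<lambda>y. g y u v) x z = dir_deriv (\<lambda>y. g y v u) x z"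
  by (rule fun_cong[OF dir_deriv_cong[OF open_S]]) (simp_all add: sym)

lemma linear_koszul: "x \<in> S \<Longrightarrow> linear (koszul x u v)"
proof -
  assume x: "x \<in> S"
  have add: "dir_deriv (\<lambda>y. g y a (z + z')) x h = dir_deriv (\<lambda>y. g y a z) x h + dir_deriv (\<lambda>y. g y a z') x h" for a z z' h
  proof (rule dir_deriv_eqI, rule has_derivative_transform_within_open[OF _ open_S x])
    show "((\<lambda>y. g y a z + g y a z') has_derivative
      (\<lambda>h. dir_deriv (\<lambda>y. g y a z) x h + dir_deriv (\<lambda>y. g y a z') x h)) (at x)"
      by (intro has_derivative_add has_derivative_metric x)
  qed (simp add: bilinear_radd[OF bilinear])
  have mul: "dir_deriv (\<lambda>y. g y a (c *\<^sub>R z)) x h = c * dir_deriv (\<lambda>y. g y a z) x h" for a c z h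
  proof (rule dir_deriv_eqI, rule has_derivative_transform_within_open[OF _ open_S x])
    show "((\<lambda>y. c * g y a z) has_derivative (\<lambda>h. c * dir_deriv (\<lambda>y. g y a z) x h)) (at x)"
      by (intro has_derivative_mult_right has_derivative_metric x)
  qed (simp add: bilinear_rmul[OF bilinear])
  have "linear (dir_deriv (\<lambda>y. g y u v) x)"
    using has_derivative_metric[OF x] has_derivative_linear by blast
  then show ?thesis
    by (intro linearI) (simp_all add: koszul_def add mul linear_add linear_cmul field_simps)
qed

lemma christoffel_koszul:
  assumes "x \<in> S" "\<And>y. G c y = g y"
  shows "g x (christoffel G c x u v) z = koszul x u v z"
proof -
  have ex1: "\<exists>!w. \<forall>z. g x w z = koszul x u v z"
    using bilinear_riesz[OF bilinear pos linear_koszul] assms by blast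
  have "(2 * g x w z = dir_deriv (\<lambda>y. g y v z) x u + dir_deriv (\<lambda>y. g y u z) x v
     - dir_deriv (\<lambda>y. g y u v) x z) \<longleftrightarrow> g x w z = koszul x u v z" for w z
    by (auto simp: koszul_def)
  then have "christoffel G c x u v = (THE w. \<forall>z. g x w z = koszul x u v z)"
    by (simp add: christoffel_def assms(2))
  then show ?thesis using theI'[OF ex1] by simp
qed

lemma smooth_on_koszul: "smooth_on S (\<lambda>y. koszul y u v z)"
proof -
  have "smooth_on S (\<lambda>y. (1/2) * (dir_deriv (\<lambda>y. g y v z) y u + (dir_deriv (\<lambda>y. g y u z) y v
     + (-1) * dir_deriv (\<lambda>y. g y u v) y z)))"
    by (intro smooth_on_add smooth_on_mult smooth_on_const smooth_on_dir_deriv smooth open_S)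
  then show ?thesis by (simp add: koszul_def field_simps)
qed

text \<open>Lowering an index turns the derivatives of the Christoffel symbols into derivatives of
  \<^term>\<open>koszul\<close>; metric compatibility absorbs the derivative of the metric.\<close>

lemma curvature_tensor_koszul:
  assumes x: "x \<in> S" and G: "\<And>y. G c y = g y"
  shows "g x (curvature_tensor G c x u v w) z =
    dir_deriv (\<lambda>y. koszul y v w z) x u - dir_deriv (\<lambda>y. koszul y u w z) x v
    - g x (christoffel G c x u z) (christoffel G c x v w)
    + g x (christoffel G c x v z) (christoffel G c x u w)"
proof -
  let ?\<Gamma> = "christoffel G c"
  have k: "g y (?\<Gamma> y a b) e = koszul y a b e" if "y \<in> S" for y a b e
    by (rule christoffel_koszul[OF that]) (rule G)
  have D: "g x (dir_deriv (\<lambda>y. ?\<Gamma> y b e) x a) z =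
     dir_deriv (\<lambda>y. koszul y b e z) x a - g x (?\<Gamma> x a (?\<Gamma> x b e)) z - g x (?\<Gamma> x a z) (?\<Gamma> x b e)" for a b e
  proof -
    have "(\<lambda>y. ?\<Gamma> y b e) differentiable at x"
      using smooth_on_has_derivative[OF smooth_on_koszul x]
      by (intro differentiable_solution[where L = "\<lambda>y. koszul y b e", OF x])
        (auto simp: k differentiable_def)
    then have "((\<lambda>y. ?\<Gamma> y b e) has_derivative dir_deriv (\<lambda>y. ?\<Gamma> y b e) x) (at x)"
      by (simp add: frechet_derivative_works)
    from dir_deriv_eqI[OF has_derivative_along_field[OF x this]]
    have "dir_deriv (\<lambda>y. g y (?\<Gamma> y b e) z) x a =
      dir_deriv (\<lambda>y. g y (?\<Gamma> x b e) z) x a + g x (dir_deriv (\<lambda>y. ?\<Gamma> y b e) x a) z" .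
    moreover have "dir_deriv (\<lambda>y. g y (?\<Gamma> y b e) z) x a = dir_deriv (\<lambda>y. koszul y b e z) x a"
      using dir_deriv_cong[OF open_S x, of "\<lambda>y. g y (?\<Gamma> y b e) z"] k by simp
    moreover have "dir_deriv (\<lambda>y. g y (?\<Gamma> x b e) z) x a =
        koszul x a (?\<Gamma> x b e) z + koszul x a z (?\<Gamma> x b e)"
      using dir_deriv_sym[OF x, of z "?\<Gamma> x b e" a] by (simp add: koszul_def field_simps)
    ultimately show ?thesis using k[OF x] by simp
  qed
  show ?thesis
    unfolding curvature_tensor_def
    by (simp add: bilinear_ladd[OF bilinear[OF x]] bilinear_lsub[OF bilinear[OF x]] D)
qed

end

section \<open>Immersed coordinate patches\<close>

lemma normal_part_unique:
  assumes "subspace T" "n \<in> T\<^sup>\<bottom>" "w - n \<in> T"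
  shows "normal_part T w = n"
  unfolding normal_part_def
proof (rule the_equality)
  fix m assume m: "m \<in> T\<^sup>\<bottom> \<and> w - m \<in> T"
  have "(w - n) - (w - m) \<in> T" using subspace_diff[OF assms(1,3)] m by blast
  then have "m - n \<in> T" by simp
  moreover have "m - n \<in> T\<^sup>\<bottom>"
    using m assms subspace_diff subspace_orthogonal_comp by blast
  ultimately have "(m - n) \<bullet> (m - n) = 0"
    unfolding orthogonal_comp_def orthogonal_def by blast
  then show "m = n" by simp
qed (use assms in auto)

lemma normal_part_mem:
  assumes "subspace T"
  shows "normal_part T w \<in> T\<^sup>\<bottom>" "w - normal_part T w \<in> T"
proof -
  obtain y z where yz: "y \<in> span T" "\<And>v. v \<in> span T \<Longrightarrow> orthogonal z v" "w = y + z"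
    using orthogonal_subspace_decomp_exists[of T w] by metis
  moreover have "span T = T" using assms by (simp add: span_eq_iff)
  ultimately have z: "z \<in> T\<^sup>\<bottom>" "w - z \<in> T"
    by (auto simp: orthogonal_comp_def orthogonal_commute)
  then have "normal_part T w = z"
    using normal_part_unique[OF assms] by blast
  then show "normal_part T w \<in> T\<^sup>\<bottom>" "w - normal_part T w \<in> T"
    using z by auto
qed

lemma normal_part_inner: "subspace T \<Longrightarrow> v \<in> T \<Longrightarrow> normal_part T w \<bullet> v = 0"
  using normal_part_mem(1)[of T w] by (auto simp: orthogonal_comp_def orthogonal_def inner_commute)

lemma normal_part_inner_left:
  "subspace T \<Longrightarrow> normal_part T a \<bullet> b = normal_part T a \<bullet> normal_part T b"
  using normal_part_inner[of T "b - normal_part T b" a] normal_part_mem(2)[of T b]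
  by (simp add: inner_diff_right)

lemma linear_normal_part:
  assumes "subspace T"
  shows "linear (normal_part T)"
proof (rule linearI)
  note m = normal_part_mem[OF assms]
  show "normal_part T (a + b) = normal_part T a + normal_part T b" for a b
    using subspace_add[OF assms m(2)[of a] m(2)[of b]]
    by (intro normal_part_unique assms subspace_add[OF subspace_orthogonal_comp] m)
       (simp add: algebra_simps)
  show "normal_part T (c *\<^sub>R a) = c *\<^sub>R normal_part T a" for c a
    using subspace_scale[OF assms m(2)[of a], of c]
    by (intro normal_part_unique assms subspace_scale[OF subspace_orthogonal_comp] m)
       (simp add: algebra_simps)
qed

lemma normal_part_eq_0: "subspace T \<Longrightarrow> w \<in> T \<Longrightarrow> normal_part T w = 0"
  by (rule normal_part_unique) (auto simp: subspace_0 subspace_orthogonal_comp)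

lemma norm_normal_part_le: "subspace T \<Longrightarrow> norm (normal_part T w) \<le> norm w"
proof -
  assume T: "subspace T"
  have "(norm (normal_part T w))\<^sup>2 = normal_part T w \<bullet> w"
    using normal_part_inner_left[OF T, of w w] by (simp add: power2_norm_eq_inner)
  also have "\<dots> \<le> norm (normal_part T w) * norm w" by (rule norm_cauchy_schwarz)
  finally show ?thesis
    by (smt (verit) mult_left_le_imp_le norm_ge_zero power2_eq_square zero_less_norm_iff norm_zero)
qed

locale immersed_chart =
  fixes S :: "'m::euclidean_space set" and F :: "'m \<Rightarrow> 'n::euclidean_space"
  assumes open_S: "open S"
    and smooth_F: "smooth_on S F"
    and inj_D: "x \<in> S \<Longrightarrow> inj (dir_deriv F x)"
begin

abbreviation D :: "'m \<Rightarrow> 'm \<Rightarrow> 'n" where "D x u \<equiv> dir_deriv F x u"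

definition D2 :: "'m \<Rightarrow> 'm \<Rightarrow> 'm \<Rightarrow> 'n" where
  "D2 x u v = dir_deriv (\<lambda>y. dir_deriv F y v) x u"

definition D3 :: "'m \<Rightarrow> 'm \<Rightarrow> 'm \<Rightarrow> 'm \<Rightarrow> 'n" where
  "D3 x u v w = dir_deriv (\<lambda>y. D2 y v w) x u"

definition nor :: "'m \<Rightarrow> 'n \<Rightarrow> 'n" where
  "nor x = normal_part (range (dir_deriv F x))"

definition sff :: "'m \<Rightarrow> 'm \<Rightarrow> 'm \<Rightarrow> 'n" where
  "sff x u v = nor x (D2 x u v)"

lemma has_derivative_F: "x \<in> S \<Longrightarrow> (F has_derivative D x) (at x)"
  by (rule smooth_on_has_derivative[OF smooth_F])

lemma has_derivative_D: "x \<in> S \<Longrightarrow> ((\<lambda>y. D y v) has_derivative (\<lambda>u. D2 x u v)) (at x)"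
  unfolding D2_def by (rule smooth_on_has_derivative[OF smooth_on_dir_deriv[OF smooth_F]])

lemma has_derivative_D2: "x \<in> S \<Longrightarrow> ((\<lambda>y. D2 y v w) has_derivative (\<lambda>u. D3 x u v w)) (at x)"
  unfolding D2_def D3_def
  by (rule smooth_on_has_derivative[OF smooth_on_dir_deriv[OF smooth_on_dir_deriv[OF smooth_F]]])

lemma linear_D: "x \<in> S \<Longrightarrow> linear (D x)"
  by (rule smooth_on_linear_dir_deriv[OF smooth_F])

lemma D2_sym: "x \<in> S \<Longrightarrow> D2 x u v = D2 x v u"
  unfolding D2_def by (rule mixed_partials[OF open_S _ smooth_F])

lemma D3_sym: "x \<in> S \<Longrightarrow> D3 x u v w = D3 x v u w"
  unfolding D3_def D2_def by (rule mixed_partials[OF open_S _ smooth_on_dir_deriv[OF smooth_F]])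

lemma linear_D2: "x \<in> S \<Longrightarrow> linear (\<lambda>u. D2 x u v)"
  using has_derivative_D has_derivative_linear by blast

lemma subspace_range_D: "x \<in> S \<Longrightarrow> subspace (range (D x))"
  using linear_D linear_subspace_image subspace_UNIV by blast

lemma linear_nor: "x \<in> S \<Longrightarrow> linear (nor x)"
  unfolding nor_def by (intro linear_normal_part subspace_range_D)

lemma nor_D: "x \<in> S \<Longrightarrow> nor x (D x u) = 0"
  unfolding nor_def by (intro normal_part_eq_0 subspace_range_D) auto

lemma nor_inner_D: "x \<in> S \<Longrightarrow> nor x w \<bullet> D x u = 0"
  unfolding nor_def by (intro normal_part_inner subspace_range_D) auto

lemma nor_inner_left: "x \<in> S \<Longrightarrow> nor x a \<bullet> b = nor x a \<bullet> nor x b"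
  unfolding nor_def by (intro normal_part_inner_left subspace_range_D)

lemma tangent_witness: "x \<in> S \<Longrightarrow> \<exists>w. a - nor x a = D x w"
  unfolding nor_def using normal_part_mem(2)[OF subspace_range_D] by blast

lemma sff_sym: "x \<in> S \<Longrightarrow> sff x u v = sff x v u"
  by (simp add: sff_def D2_sym)

lemma sff_add_left: "x \<in> S \<Longrightarrow> sff x (u + u') v = sff x u v + sff x u' v"
  by (simp add: sff_def linear_add[OF linear_D2] linear_add[OF linear_nor])

lemma sff_scale_left: "x \<in> S \<Longrightarrow> sff x (c *\<^sub>R u) v = c *\<^sub>R sff x u v"
  by (simp add: sff_def linear_cmul[OF linear_D2] linear_cmul[OF linear_nor])

lemma sff_add_right: "x \<in> S \<Longrightarrow> sff x u (v + v') = sff x u v + sff x u v'"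
  using sff_add_left sff_sym by metis

lemma sff_scale_right: "x \<in> S \<Longrightarrow> sff x u (c *\<^sub>R v) = c *\<^sub>R sff x u v"
  using sff_scale_left sff_sym by metis

definition conf :: "'m \<Rightarrow> real" where "conf y = exp (- 3 * (F y \<bullet> F y))"

lemma conf_pos: "conf y > 0"
  by (simp add: conf_def)

lemma smooth_conf: "smooth_on S conf"
  unfolding conf_def
  by (intro smooth_on_exp smooth_on_mult smooth_on_const smooth_on_inner smooth_F open_S)

lemma has_derivative_conf:
  "x \<in> S \<Longrightarrow> (conf has_derivative (\<lambda>h. conf x * (- 6 * (F x \<bullet> D x h)))) (at x)"
  unfolding conf_def
  by (auto intro!: derivative_eq_intros has_derivative_F simp: fun_eq_iff inner_commute)

definition cmetric :: "'m \<Rightarrow> 'm \<Rightarrow> 'm \<Rightarrow> real" where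
  "cmetric y u v = conf y * (D y u \<bullet> D y v)"

sublocale first: coordinate_metric S "\<lambda>y u v. D y u \<bullet> D y v"
proof
  show "open S" by (rule open_S)
  show "smooth_on S (\<lambda>x. D x u \<bullet> D x v)" for u v
    by (intro smooth_on_inner smooth_on_dir_deriv smooth_F open_S)
  fix x assume x: "x \<in> S"
  show "bilinear (\<lambda>u v. D x u \<bullet> D x v)"
    unfolding bilinear_def using linear_D[OF x]
    by (auto intro!: linearI simp: linear_add linear_cmul inner_add_left inner_add_right)
  show "D x u \<bullet> D x v = D x v \<bullet> D x u" for u v by (rule inner_commute)
  show "0 < D x u \<bullet> D x u" if "u \<noteq> 0" for u
    using that inj_D[OF x] linear_injective_0[OF linear_D[OF x]] by auto
qed

sublocale conformal: coordinate_metric S cmetric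
proof
  show "open S" by (rule open_S)
  show "smooth_on S (\<lambda>x. cmetric x u v)" for u v
    unfolding cmetric_def by (intro smooth_on_mult first.smooth smooth_conf open_S)
  fix x assume x: "x \<in> S"
  show "bilinear (cmetric x)"
    unfolding bilinear_def cmetric_def using linear_D[OF x]
    by (auto intro!: linearI
        simp: linear_add linear_cmul inner_add_left inner_add_right distrib_left)
  show "cmetric x u v = cmetric x v u" for u v by (simp add: cmetric_def inner_commute)
  show "0 < cmetric x u u" if "u \<noteq> 0" for u
    using first.pos[OF x that] conf_pos by (simp add: cmetric_def)
qed

text \<open>The conformal factor \<^const>\<open>conf\<close> is \<open>exp (2 \<phi>)\<close> for \<open>\<phi> = - 3 |F|\<^sup>2 / 2\<close>; the last three terms
  below are \<open>d\<phi>(v) w + d\<phi>(w) v - \<langle>v,w\<rangle> \<nabla>\<phi>\<close>, up to normal components.\<close>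

definition B :: "'m \<Rightarrow> 'm \<Rightarrow> 'm \<Rightarrow> 'n" where
  "B y v w = D2 y v w - (3 * (F y \<bullet> D y v)) *\<^sub>R D y w - (3 * (F y \<bullet> D y w)) *\<^sub>R D y v
     + (3 * (D y v \<bullet> D y w)) *\<^sub>R F y"

lemma koszul_cmetric:
  assumes x: "x \<in> S"
  shows "conformal.koszul x v w z = conf x * (B x v w \<bullet> D x z)"
proof -
  have d: "dir_deriv (\<lambda>y. cmetric y a b) x h =
     conf x * (D2 x h a \<bullet> D x b + D x a \<bullet> D2 x h b - 6 * (F x \<bullet> D x h) * (D x a \<bullet> D x b))" for a b h
    unfolding cmetric_def
    by (rule dir_deriv_eqI, rule has_derivative_eq_rhs,
        (rule has_derivative_mult has_derivative_inner has_derivative_conf has_derivative_D x)+)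
       (simp add: fun_eq_iff algebra_simps)
  show ?thesis
    unfolding conformal.koszul_def d B_def
    by (simp add: inner_simps D2_sym[OF x, of w v] D2_sym[OF x, of z] inner_commute field_simps)
qed

lemma B_sym: "x \<in> S \<Longrightarrow> B x v w = B x w v"
  by (simp add: B_def D2_sym[of x v w] inner_commute)

lemma has_derivative_B:
  assumes x: "x \<in> S"
  shows "((\<lambda>y. B y v w) has_derivative (\<lambda>h. D3 x h v w
     - (3 * (D x h \<bullet> D x v + F x \<bullet> D2 x h v)) *\<^sub>R D x w - (3 * (F x \<bullet> D x v)) *\<^sub>R D2 x h w
     - (3 * (D x h \<bullet> D x w + F x \<bullet> D2 x h w)) *\<^sub>R D x v - (3 * (F x \<bullet> D x w)) *\<^sub>R D2 x h v
     + (3 * (D2 x h v \<bullet> D x w + D x v \<bullet> D2 x h w)) *\<^sub>R F x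
     + (3 * (D x v \<bullet> D x w)) *\<^sub>R D x h)) (at x)"
  unfolding B_def
  by (rule has_derivative_eq_rhs,
      (rule has_derivative_add has_derivative_diff has_derivative_scaleR has_derivative_mult_right
        has_derivative_inner has_derivative_D has_derivative_D2 has_derivative_F x)+)
     (simp add: fun_eq_iff algebra_simps)

lemma tangential_inner:
  assumes x: "x \<in> S" and "\<And>z. D x s \<bullet> D x z = a \<bullet> D x z" "\<And>z. D x t \<bullet> D x z = b \<bullet> D x z"
  shows "D x s \<bullet> D x t = a \<bullet> b - nor x a \<bullet> nor x b"
proof -
  obtain w where w: "b - nor x b = D x w" using tangent_witness[OF x] by blast
  have "D x s \<bullet> D x t = b \<bullet> D x s" using assms(3)[of s] by (simp add: inner_commute)
  also have "\<dots> = D x w \<bullet> D x s"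
    using nor_inner_D[OF x, of b s] w[symmetric] by (simp add: inner_diff_left)
  also have "\<dots> = a \<bullet> (b - nor x b)" using assms(2)[of w] w by (simp add: inner_commute)
  also have "\<dots> = a \<bullet> b - nor x a \<bullet> nor x b"
    using nor_inner_left[OF x, of b a] by (simp add: inner_diff_right inner_commute)
  finally show ?thesis .
qed

lemma curvature_numerator:
  fixes u v :: 'm
  assumes x: "x \<in> S" and G: "\<And>y. G c y = cmetric y"
  defines "a \<equiv> D x u" and "b \<equiv> D x v" and "N \<equiv> nor x (F x)"
  shows "cmetric x (curvature_tensor G c x u v v) u = conf x *
    (6 * ((a \<bullet> a) * (b \<bullet> b) - (a \<bullet> b)\<^sup>2)
     + 9 * ((b \<bullet> b) * (F x \<bullet> a)\<^sup>2 + (a \<bullet> a) * (F x \<bullet> b)\<^sup>2 - 2 * (a \<bullet> b) * (F x \<bullet> a) * (F x \<bullet> b))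
     - 9 * (F x \<bullet> F x) * ((a \<bullet> a) * (b \<bullet> b) - (a \<bullet> b)\<^sup>2)
     + (sff x u u + (3 * (a \<bullet> a)) *\<^sub>R N) \<bullet> (sff x v v + (3 * (b \<bullet> b)) *\<^sub>R N)
     - (sff x u v + (3 * (a \<bullet> b)) *\<^sub>R N) \<bullet> (sff x u v + (3 * (a \<bullet> b)) *\<^sub>R N))"
proof -
  let ?\<Gamma> = "christoffel G c x"
  have \<Gamma>: "D x (?\<Gamma> p q) \<bullet> D x z = B x p q \<bullet> D x z" for p q z
    using conformal.christoffel_koszul[OF x, of G c p q z] G koszul_cmetric[OF x, of p q z] conf_pos[of x]
    by (simp add: cmetric_def)
  have \<Gamma>\<Gamma>: "cmetric x (?\<Gamma> p q) (?\<Gamma> r s) = conf x * (B x p q \<bullet> B x r s - nor x (B x p q) \<bullet> nor x (B x r s))"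
    for p q r s
    unfolding cmetric_def using tangential_inner[OF x \<Gamma> \<Gamma>] by simp
  have norB: "nor x (B x p q) = sff x p q + (3 * (D x p \<bullet> D x q)) *\<^sub>R N" for p q
    unfolding B_def sff_def N_def using linear_nor[OF x]
    by (simp add: linear_add linear_diff linear_cmul nor_D[OF x])
  have dk: "dir_deriv (\<lambda>y. conformal.koszul y p q z) x h = conf x *
     (- 6 * (F x \<bullet> D x h) * (B x p q \<bullet> D x z) + B x p q \<bullet> D2 x h z
       + dir_deriv (\<lambda>y. B y p q) x h \<bullet> D x z)" for p q z h
  proof -
    have "dir_deriv (\<lambda>y. conformal.koszul y p q z) x h = dir_deriv (\<lambda>y. conf y * (B y p q \<bullet> D y z)) x h"
      by (rule fun_cong[OF dir_deriv_cong[OF open_S x]]) (rule koszul_cmetric)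
    also have "\<dots> = conf x *
     (- 6 * (F x \<bullet> D x h) * (B x p q \<bullet> D x z) + B x p q \<bullet> D2 x h z
       + dir_deriv (\<lambda>y. B y p q) x h \<bullet> D x z)"
    proof -
      have "((\<lambda>y. B y p q) has_derivative dir_deriv (\<lambda>y. B y p q) x) (at x)"
        using has_derivative_B[OF x] unfolding frechet_derivative_works[symmetric] differentiable_def
        by blast
      from dir_deriv_eqI[OF has_derivative_mult[OF has_derivative_conf[OF x]
          has_derivative_inner[OF this has_derivative_D[OF x]]]]
      show ?thesis by (simp add: algebra_simps)
    qed
    finally show ?thesis .
  qed
  have "cmetric x (curvature_tensor G c x u v v) u = conf x *
     (- 6 * (F x \<bullet> a) * (B x v v \<bullet> a) + B x v v \<bullet> D2 x u u + dir_deriv (\<lambda>y. B y v v) x u \<bullet> a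
      + 6 * (F x \<bullet> b) * (B x u v \<bullet> a) - B x u v \<bullet> D2 x u v - dir_deriv (\<lambda>y. B y u v) x v \<bullet> a
      - B x u u \<bullet> B x v v + B x u v \<bullet> B x u v
      + nor x (B x u u) \<bullet> nor x (B x v v) - nor x (B x u v) \<bullet> nor x (B x u v))"
  proof -
    have "cmetric x (curvature_tensor G c x u v v) u =
        dir_deriv (\<lambda>y. conformal.koszul y v v u) x u - dir_deriv (\<lambda>y. conformal.koszul y u v u) x v
        - cmetric x (?\<Gamma> u u) (?\<Gamma> v v) + cmetric x (?\<Gamma> v u) (?\<Gamma> u v)"
      by (rule conformal.curvature_tensor_koszul[OF x]) (rule G)
    then show ?thesis
      unfolding dk \<Gamma>\<Gamma> B_sym[OF x, of v u] D2_sym[OF x, of v u] a_def b_def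
      by (simp only: ring_distribs)
  qed
  moreover have "- 6 * (F x \<bullet> a) * (B x v v \<bullet> a) + B x v v \<bullet> D2 x u u + dir_deriv (\<lambda>y. B y v v) x u \<bullet> a
      + 6 * (F x \<bullet> b) * (B x u v \<bullet> a) - B x u v \<bullet> D2 x u v - dir_deriv (\<lambda>y. B y u v) x v \<bullet> a
      - B x u u \<bullet> B x v v + B x u v \<bullet> B x u v =
     6 * ((a \<bullet> a) * (b \<bullet> b) - (a \<bullet> b)\<^sup>2)
     + 9 * ((b \<bullet> b) * (F x \<bullet> a)\<^sup>2 + (a \<bullet> a) * (F x \<bullet> b)\<^sup>2 - 2 * (a \<bullet> b) * (F x \<bullet> a) * (F x \<bullet> b))
     - 9 * (F x \<bullet> F x) * ((a \<bullet> a) * (b \<bullet> b) - (a \<bullet> b)\<^sup>2)"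
    unfolding dir_deriv_eqI[OF has_derivative_B[OF x]]
    unfolding D3_sym[OF x, of v u v] D2_sym[OF x, of v u] a_def[symmetric] b_def[symmetric] B_def power2_eq_square
    by (simp add: inner_simps inner_commute algebra_simps)
  moreover have "nor x (B x u u) = sff x u u + (3 * (a \<bullet> a)) *\<^sub>R N"
    "nor x (B x v v) = sff x v v + (3 * (b \<bullet> b)) *\<^sub>R N"
    "nor x (B x u v) = sff x u v + (3 * (a \<bullet> b)) *\<^sub>R N"
    unfolding a_def b_def by (rule norB)+
  ultimately show ?thesis by (simp only:)
qed

end

lemma orthonormal_curvature_pos:
  fixes P Q R a b f N :: "'n::real_inner"
  assumes "P \<bullet> P < 3/2" "R \<bullet> R < 3/2"
    "((1/2) *\<^sub>R (P + R) + Q) \<bullet> ((1/2) *\<^sub>R (P + R) + Q) < 3/2"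
    "((1/2) *\<^sub>R (P + R) - Q) \<bullet> ((1/2) *\<^sub>R (P + R) - Q) < 3/2"
    and "3 * (f \<bullet> f) - 2 * (N \<bullet> N) \<le> 1"
  shows "0 < 6 + 9 * ((f \<bullet> a)\<^sup>2 + (f \<bullet> b)\<^sup>2) - 9 * (f \<bullet> f)
     + (P + 3 *\<^sub>R N) \<bullet> (R + 3 *\<^sub>R N) - Q \<bullet> Q"
proof -
  have sq: "((1/2) *\<^sub>R (P + R) + M) \<bullet> ((1/2) *\<^sub>R (P + R) + M)
      = (P \<bullet> P) / 4 + (R \<bullet> R) / 4 + (P \<bullet> R) / 2 + P \<bullet> M + R \<bullet> M + M \<bullet> M" for M
    by (simp add: inner_simps inner_commute field_simps)
  have "0 \<le> ((1/2) *\<^sub>R (P + R) + N) \<bullet> ((1/2) *\<^sub>R (P + R) + N)" by simp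
  moreover have "(P + 3 *\<^sub>R N) \<bullet> (R + 3 *\<^sub>R N)
      = P \<bullet> R + 3 * (P \<bullet> N) + 3 * (R \<bullet> N) + 9 * (N \<bullet> N)"
    by (simp add: inner_simps inner_commute)
  ultimately have "0 < 6 - 9 * (f \<bullet> f) + (P + 3 *\<^sub>R N) \<bullet> (R + 3 *\<^sub>R N) - Q \<bullet> Q"
    using assms sq[of N] sq[of Q] sq[of "- Q"] by simp
  moreover have "0 \<le> 9 * ((f \<bullet> a)\<^sup>2 + (f \<bullet> b)\<^sup>2)" by simp
  ultimately show ?thesis by linarith
qed

lemma curvature_expression_change_basis:
  fixes P Q R a b f N :: "'n::real_inner" and \<alpha> \<beta> \<gamma> :: real
  assumes "a \<bullet> a = 1" "b \<bullet> b = 1" "a \<bullet> b = 0"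
    and K: "\<And>x y X Y Z. K x y X Y Z = 
     6 * ((x \<bullet> x) * (y \<bullet> y) - (x \<bullet> y)\<^sup>2)
     + 9 * ((y \<bullet> y) * (f \<bullet> x)\<^sup>2 + (x \<bullet> x) * (f \<bullet> y)\<^sup>2 - 2 * (x \<bullet> y) * (f \<bullet> x) * (f \<bullet> y))
     - 9 * (f \<bullet> f) * ((x \<bullet> x) * (y \<bullet> y) - (x \<bullet> y)\<^sup>2)
     + (X + (3 * (x \<bullet> x)) *\<^sub>R N) \<bullet> (Z + (3 * (y \<bullet> y)) *\<^sub>R N)
     - (Y + (3 * (x \<bullet> y)) *\<^sub>R N) \<bullet> (Y + (3 * (x \<bullet> y)) *\<^sub>R N)"
  shows "K (\<alpha> *\<^sub>R a) (\<beta> *\<^sub>R a + \<gamma> *\<^sub>R b) (\<alpha>\<^sup>2 *\<^sub>R P) ((\<alpha> * \<beta>) *\<^sub>R P + (\<alpha> * \<gamma>) *\<^sub>R Q)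
      (\<beta>\<^sup>2 *\<^sub>R P + (2 * \<beta> * \<gamma>) *\<^sub>R Q + \<gamma>\<^sup>2 *\<^sub>R R) = (\<alpha> * \<gamma>)\<^sup>2 * K a b P Q R"
  unfolding K
  by (simp add: inner_simps assms(1-3) inner_commute[of b a] inner_commute power2_eq_square algebra_simps)

context immersed_chart
begin

lemma orthonormal_frame:
  assumes x: "x \<in> S" and uv: "u \<noteq> v" "independent {u, v}"
  obtains \<alpha> \<beta> \<gamma> p q where "\<alpha> > 0" "\<gamma> > 0" "u = \<alpha> *\<^sub>R p" "v = \<beta> *\<^sub>R p + \<gamma> *\<^sub>R q"
    "D x p \<bullet> D x p = 1" "D x q \<bullet> D x q = 1" "D x p \<bullet> D x q = 0"
proof -
  note lin = linear_D[OF x]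
  have "u \<noteq> 0" using uv dependent_zero[of "{u, v}"] by auto
  define \<alpha> where "\<alpha> = norm (D x u)"
  have \<alpha>: "\<alpha> > 0" using first.pos[OF x \<open>u \<noteq> 0\<close>] by (simp add: \<alpha>_def)
  define p where "p = (1 / \<alpha>) *\<^sub>R u"
  have u: "u = \<alpha> *\<^sub>R p" using \<alpha> by (simp add: p_def)
  have p1: "D x p \<bullet> D x p = 1"
    using \<alpha> by (simp add: p_def linear_cmul[OF lin] power2_norm_eq_inner[symmetric] \<alpha>_def power2_eq_square)
  define \<beta> where "\<beta> = D x v \<bullet> D x p"
  define r where "r = v - \<beta> *\<^sub>R p"
  have "r \<noteq> 0"
  proof
    assume "r = 0"
    then have "v = (\<beta> / \<alpha>) *\<^sub>R u" by (simp add: r_def p_def)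
    then have "v \<in> span {u}" by (simp add: span_base span_scale)
    moreover have "{u, v} - {v} = {u}" using uv(1) by auto
    ultimately have "dependent {u, v}"
      by (auto simp: dependent_def)
    then show False using uv by simp
  qed
  define \<gamma> where "\<gamma> = norm (D x r)"
  have \<gamma>: "\<gamma> > 0" using first.pos[OF x \<open>r \<noteq> 0\<close>] by (simp add: \<gamma>_def)
  define q where "q = (1 / \<gamma>) *\<^sub>R r"
  have v: "v = \<beta> *\<^sub>R p + \<gamma> *\<^sub>R q" using \<gamma> by (simp add: q_def r_def)
  have q1: "D x q \<bullet> D x q = 1"
    using \<gamma> by (simp add: q_def linear_cmul[OF lin] power2_norm_eq_inner[symmetric] \<gamma>_def power2_eq_square)
  have "D x p \<bullet> D x r = 0"
    by (simp add: r_def linear_diff[OF lin] linear_cmul[OF lin] inner_diff_right p1 \<beta>_def inner_commute)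
  then have pq: "D x p \<bullet> D x q = 0"
    by (simp add: q_def linear_cmul[OF lin])
  show thesis using that[OF \<alpha> \<gamma> u v p1 q1 pq] .
qed

lemma sectional_curvature_cmetric_pos:
  assumes x: "x \<in> S" and G: "\<And>y. G c y = cmetric y"
    and curv: "\<And>w. D x w \<bullet> D x w = 1 \<Longrightarrow> sff x w w \<bullet> sff x w w < 3/2"
    and radial: "3 * (F x \<bullet> F x) - 2 * (nor x (F x) \<bullet> nor x (F x)) \<le> 1"
    and uv: "u \<noteq> v" "independent {u, v}"
  shows "0 < sectional_curvature G c x u v"
proof -
  note lin = linear_D[OF x]
  obtain \<alpha> \<beta> \<gamma> p q where \<alpha>\<gamma>: "\<alpha> > 0" "\<gamma> > 0" and u: "u = \<alpha> *\<^sub>R p" and v: "v = \<beta> *\<^sub>R p + \<gamma> *\<^sub>R q"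
    and on: "D x p \<bullet> D x p = 1" "D x q \<bullet> D x q = 1" "D x p \<bullet> D x q = 0"
    using orthonormal_frame[OF x uv] .
  have Duv: "D x u = \<alpha> *\<^sub>R D x p" "D x v = \<beta> *\<^sub>R D x p + \<gamma> *\<^sub>R D x q"
    by (simp_all add: u v linear_cmul[OF lin] linear_add[OF lin])
  note sff = sff_add_left[OF x] sff_add_right[OF x] sff_scale_left[OF x] sff_scale_right[OF x]
    sff_sym[OF x, of q p]
  define P where "P = sff x p p"
  define Q where "Q = sff x p q"
  define R where "R = sff x q q"
  have sff_uv: "sff x u u = \<alpha>\<^sup>2 *\<^sub>R P" "sff x u v = (\<alpha> * \<beta>) *\<^sub>R P + (\<alpha> * \<gamma>) *\<^sub>R Q"
    "sff x v v = \<beta>\<^sup>2 *\<^sub>R P + (2 * \<beta> * \<gamma>) *\<^sub>R Q + \<gamma>\<^sup>2 *\<^sub>R R"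
    unfolding u v P_def Q_def R_def
    by (simp_all add: sff power2_eq_square algebra_simps scaleR_2[symmetric])
  define K where "K a b X Y Z =
     6 * ((a \<bullet> a) * (b \<bullet> b) - (a \<bullet> b)\<^sup>2)
     + 9 * ((b \<bullet> b) * (F x \<bullet> a)\<^sup>2 + (a \<bullet> a) * (F x \<bullet> b)\<^sup>2 - 2 * (a \<bullet> b) * (F x \<bullet> a) * (F x \<bullet> b))
     - 9 * (F x \<bullet> F x) * ((a \<bullet> a) * (b \<bullet> b) - (a \<bullet> b)\<^sup>2)
     + (X + (3 * (a \<bullet> a)) *\<^sub>R nor x (F x)) \<bullet> (Z + (3 * (b \<bullet> b)) *\<^sub>R nor x (F x))
     - (Y + (3 * (a \<bullet> b)) *\<^sub>R nor x (F x)) \<bullet> (Y + (3 * (a \<bullet> b)) *\<^sub>R nor x (F x))" for a b X Y Z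
  have num: "cmetric x (curvature_tensor G c x u v v) u = conf x * ((\<alpha> * \<gamma>)\<^sup>2 * K (D x p) (D x q) P Q R)"
  proof -
    have "cmetric x (curvature_tensor G c x u v v) u =
        conf x * K (D x u) (D x v) (sff x u u) (sff x u v) (sff x v v)"
      unfolding K_def by (rule curvature_numerator[OF x]) (rule G)
    then show ?thesis
      unfolding Duv sff_uv curvature_expression_change_basis[OF on K_def] .
  qed
  let ?h = "sqrt (1/2)"
  have h: "?h * ?h = 1/2" by (simp add: real_sqrt_mult[symmetric])
  have "P \<bullet> P < 3/2" "R \<bullet> R < 3/2"
    using curv on by (simp_all add: P_def R_def)
  moreover have "((1/2) *\<^sub>R (P + R) + Q) \<bullet> ((1/2) *\<^sub>R (P + R) + Q) < 3/2"
  proof -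
    have "sff x (?h *\<^sub>R p + ?h *\<^sub>R q) (?h *\<^sub>R p + ?h *\<^sub>R q) = (?h * ?h) *\<^sub>R (P + Q + Q + R)"
      unfolding P_def Q_def R_def by (simp only: sff scaleR_scaleR scaleR_add_right add_ac)
    also have "P + Q + Q + R = (P + R) + 2 *\<^sub>R Q" by (simp add: scaleR_2 add_ac)
    also have "(?h * ?h) *\<^sub>R ((P + R) + 2 *\<^sub>R Q) = (1/2) *\<^sub>R (P + R) + Q"
      unfolding h by (simp add: scaleR_add_right)
    finally show ?thesis
      using curv[of "?h *\<^sub>R p + ?h *\<^sub>R q"] on h
      by (simp add: linear_add[OF lin] linear_cmul[OF lin] inner_simps inner_commute)
  qed
  moreover have "((1/2) *\<^sub>R (P + R) - Q) \<bullet> ((1/2) *\<^sub>R (P + R) - Q) < 3/2"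
  proof -
    have "sff x (?h *\<^sub>R p + (- ?h) *\<^sub>R q) (?h *\<^sub>R p + (- ?h) *\<^sub>R q) = (?h * ?h) *\<^sub>R (P - Q - Q + R)"
      unfolding P_def Q_def R_def
      by (simp only: sff scaleR_scaleR scaleR_add_right scaleR_diff_right) (simp add: algebra_simps)
    also have "P - Q - Q + R = (P + R) - 2 *\<^sub>R Q" by (simp add: scaleR_2 algebra_simps)
    also have "(?h * ?h) *\<^sub>R ((P + R) - 2 *\<^sub>R Q) = (1/2) *\<^sub>R (P + R) - Q"
      unfolding h by (simp add: scaleR_diff_right)
    finally show ?thesis
      using curv[of "?h *\<^sub>R p + (- ?h) *\<^sub>R q"] on h
      by (simp add: linear_add[OF lin] linear_diff[OF lin] linear_cmul[OF lin] linear_neg[OF lin] inner_simps inner_commute)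
  qed
  ultimately have "0 < K (D x p) (D x q) P Q R"
    using orthonormal_curvature_pos[OF _ _ _ _ radial, of P R Q "D x p" "D x q"]
    by (simp add: K_def on)
  then have "0 < G c x (curvature_tensor G c x u v v) u"
    unfolding G num using \<alpha>\<gamma> conf_pos by simp
  moreover have "G c x u u * G c x v v - (G c x u v)\<^sup>2 = (conf x * \<alpha> * \<gamma>)\<^sup>2"
    unfolding G cmetric_def Duv
    by (simp add: inner_simps on inner_commute[of "D x q" "D x p"] power2_eq_square algebra_simps)
  moreover have "(conf x * \<alpha> * \<gamma>)\<^sup>2 > 0"
    using \<alpha>\<gamma> conf_pos[of x] by simp
  ultimately show ?thesis
    unfolding sectional_curvature_def by simp
qed

definition radial :: "'m \<Rightarrow> real" where
  "radial x = (norm (F x))\<^sup>2 + 2 * (norm (F x - nor x (F x)))\<^sup>2"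

lemma tangential_part_field:
  "\<exists>w. \<forall>x\<in>S. F x - nor x (F x) = D x (w x) \<and> (\<forall>z. D x (w x) \<bullet> D x z = F x \<bullet> D x z)"
proof (rule bchoice, rule ballI)
  fix x assume x: "x \<in> S"
  obtain w where w: "F x - nor x (F x) = D x w" using tangent_witness[OF x] by blast
  then have "D x w \<bullet> D x z = F x \<bullet> D x z" for z
    using nor_inner_D[OF x, of "F x" z] by (simp add: w[symmetric] inner_diff_left)
  with w show "\<exists>w. F x - nor x (F x) = D x w \<and> (\<forall>z. D x w \<bullet> D x z = F x \<bullet> D x z)" by blast
qed

lemma continuous_on_radial: "continuous_on S radial"
proof -
  obtain w where w: "\<And>x. x \<in> S \<Longrightarrow> F x - nor x (F x) = D x (w x)"
    "\<And>x z. x \<in> S \<Longrightarrow> D x (w x) \<bullet> D x z = F x \<bullet> D x z"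
    using tangential_part_field by blast
  have L: "smooth_on S (\<lambda>y. F y \<bullet> D y z)" for z
    by (intro smooth_on_inner smooth_on_dir_deriv smooth_F open_S)
  have "w differentiable at x" if "x \<in> S" for x
    using first.differentiable_solution[OF that w(2)] smooth_on_has_derivative[OF L that]
    unfolding differentiable_def by blast
  then have cw: "continuous_on S w"
    by (meson continuous_at_imp_continuous_on differentiable_imp_continuous_within)
  have "radial x = (norm (F x))\<^sup>2 + 2 * (\<Sum>b\<in>Basis. (w x \<bullet> b) * (F x \<bullet> D x b))" if x: "x \<in> S" for x
  proof -
    have "D x (w x) = D x (\<Sum>b\<in>Basis. (w x \<bullet> b) *\<^sub>R b)" by (simp add: euclidean_representation)
    also have "\<dots> = (\<Sum>b\<in>Basis. (w x \<bullet> b) *\<^sub>R D x b)"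
      using linear_D[OF x] by (simp add: linear_sum linear_cmul)
    finally have "F x \<bullet> D x (w x) = (\<Sum>b\<in>Basis. (w x \<bullet> b) * (F x \<bullet> D x b))"
      by (simp add: inner_sum_right)
    then show ?thesis
      using w(2)[OF x, of "w x"] by (simp add: radial_def w(1)[OF x] power2_norm_eq_inner)
  qed
  moreover have "continuous_on S (\<lambda>x. (norm (F x))\<^sup>2 + 2 * (\<Sum>b\<in>Basis. (w x \<bullet> b) * (F x \<bullet> D x b)))"
    by (intro continuous_intros cw smooth_on_imp_continuous_on[OF smooth_F]
        smooth_on_imp_continuous_on[OF L])
  ultimately show ?thesis by (simp cong: continuous_on_cong)
qed

text \<open>Freezing the coordinates \<open>w\<close> of the tangential part of \<open>F\<close> at a maximum \<open>x\<close> gives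
  a smooth function below \<^const>\<open>radial\<close> that touches it at \<open>x\<close>, since
  \<open>2 \<langle>F, DF w\<rangle> - |DF w|\<^sup>2\<close> is at most the squared length of the tangential part.\<close>

lemma radial_maximum:
  assumes x: "x \<in> S" and max: "\<And>y. y \<in> S \<Longrightarrow> radial y \<le> radial x"
    and curv: "\<And>w. D x w \<bullet> D x w = 1 \<Longrightarrow> sff x w w \<bullet> sff x w w < 3/2"
    and F: "norm (F x) \<le> 1"
  shows "radial x \<le> 1"
proof -
  obtain w where w: "F x - nor x (F x) = D x w" "\<And>z. D x w \<bullet> D x z = F x \<bullet> D x z"
    using tangential_part_field x by blast
  define \<sigma> where "\<sigma> y = F y \<bullet> F y + 2 * (2 * (F y \<bullet> D y w) - D y w \<bullet> D y w)" for y
  have le: "\<sigma> y \<le> radial y" if y: "y \<in> S" for y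
  proof -
    have "F y \<bullet> D y w = (F y - nor y (F y)) \<bullet> D y w"
      using nor_inner_D[OF y] by (simp add: inner_diff_left)
    moreover have "0 \<le> ((F y - nor y (F y)) - D y w) \<bullet> ((F y - nor y (F y)) - D y w)" by simp
    then have "2 * ((F y - nor y (F y)) \<bullet> D y w) - D y w \<bullet> D y w \<le> (F y - nor y (F y)) \<bullet> (F y - nor y (F y))"
      by (simp only: inner_diff_left[of "F y - nor y (F y)"] inner_diff_right[of _ "F y - nor y (F y)"]
          inner_commute[of "D y w" "F y - nor y (F y)"])
    ultimately show ?thesis
      by (simp add: \<sigma>_def radial_def power2_norm_eq_inner)
  qed
  have eq: "\<sigma> x = radial x"
    using w(2)[of w] by (simp add: \<sigma>_def radial_def power2_norm_eq_inner w(1))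
  have der: "(\<sigma> has_derivative (\<lambda>h. 2 * (F x \<bullet> D x h)
      + 2 * (2 * (D x h \<bullet> D x w + F x \<bullet> D2 x h w) - 2 * (D2 x h w \<bullet> D x w)))) (at x)"
    unfolding \<sigma>_def
    by (rule has_derivative_eq_rhs,
        (rule has_derivative_add has_derivative_diff has_derivative_mult_right
          has_derivative_inner has_derivative_D has_derivative_F x)+)
       (simp add: fun_eq_iff inner_commute)
  have "(\<lambda>h. 2 * (F x \<bullet> D x h) + 2 * (2 * (D x h \<bullet> D x w + F x \<bullet> D2 x h w) - 2 * (D2 x h w \<bullet> D x w)))
      = (\<lambda>h. 0)"
    using le eq max by (intro differential_zero_maxmin[OF x open_S der]) (metis order.trans)
  from fun_cong[OF this, of w] have "6 * (D x w \<bullet> D x w) + 4 * ((F x - D x w) \<bullet> D2 x w w) = 0"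
    using w(2)[of w] by (simp add: inner_diff_left inner_diff_right inner_commute)
  moreover have "F x - D x w = nor x (F x)" using w(1) by (simp add: algebra_simps)
  ultimately have crit: "6 * (D x w \<bullet> D x w) + 4 * (nor x (F x) \<bullet> sff x w w) = 0"
    using nor_inner_left[OF x] by (simp add: sff_def)
  have "w = 0"
  proof (rule ccontr)
    assume "w \<noteq> 0"
    define t where "t = norm (D x w)"
    have t: "t > 0" using first.pos[OF x \<open>w \<noteq> 0\<close>] by (simp add: t_def)
    define e where "e = (1 / t) *\<^sub>R w"
    have we: "w = t *\<^sub>R e" using t by (simp add: e_def)
    have "D x e \<bullet> D x e = 1"
      using t by (simp add: e_def linear_cmul[OF linear_D[OF x]] power2_norm_eq_inner[symmetric] t_def power2_eq_square)
    then have "(norm (sff x e e))\<^sup>2 < 3/2" using curv by (simp add: power2_norm_eq_inner)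
    also have "\<dots> < (3/2)\<^sup>2" by (simp add: power2_eq_square)
    finally have "norm (sff x e e) < 3/2"
      by (rule power_less_imp_less_base) simp
    moreover have "norm (nor x (F x)) \<le> 1"
      using norm_normal_part_le[OF subspace_range_D[OF x]] F by (fastforce simp: nor_def intro: order_trans)
    ultimately have "norm (nor x (F x)) * norm (sff x e e) \<le> 1 * norm (sff x e e)"
      by (intro mult_right_mono) auto
    moreover have "\<bar>nor x (F x) \<bullet> sff x e e\<bar> \<le> norm (nor x (F x)) * norm (sff x e e)"
      by (rule Cauchy_Schwarz_ineq2)
    ultimately have "6 + 4 * (nor x (F x) \<bullet> sff x e e) > 0"
      using \<open>norm (sff x e e) < 3/2\<close> by linarith
    moreover have "6 * (D x w \<bullet> D x w) + 4 * (nor x (F x) \<bullet> sff x w w)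
        = t\<^sup>2 * (6 + 4 * (nor x (F x) \<bullet> sff x e e))"
    proof -
      have "D x w \<bullet> D x w = t\<^sup>2" by (simp add: t_def power2_norm_eq_inner)
      moreover have "sff x w w = t\<^sup>2 *\<^sub>R sff x e e"
        by (simp add: we sff_scale_left[OF x] sff_scale_right[OF x] power2_eq_square)
      ultimately show ?thesis by (simp add: algebra_simps)
    qed
    ultimately show False using crit t by simp
  qed
  then have "F x - nor x (F x) = 0"
    using w(1) linear_0[OF linear_D[OF x]] by simp
  then show ?thesis
    using F by (simp add: radial_def power_le_one)
qed

end

section \<open>Closed immersed manifolds\<close>

locale immersed_manifold =
  fixes X :: "'a topology"
    and A :: "('a, 'm::euclidean_space) chart set"
    and f :: "'a \<Rightarrow> 'n::euclidean_space"
  assumes manifold: "closed_smooth_manifold X A"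
    and immersion: "immersion A f"
begin

lemma is_chart: "c \<in> A \<Longrightarrow> is_chart X c"
  using manifold by (simp add: closed_smooth_manifold_def smooth_atlas_def)

lemma chart_dom_subset: "c \<in> A \<Longrightarrow> chart_dom c \<subseteq> topspace X"
  using is_chart openin_subset unfolding is_chart_def by blast

lemma chart_cover: "p \<in> topspace X \<Longrightarrow> \<exists>c\<in>A. p \<in> chart_dom c"
  using manifold by (auto simp: closed_smooth_manifold_def smooth_atlas_def)

lemma homeomorphic_chart:
  "c \<in> A \<Longrightarrow> homeomorphic_map (subtopology X (chart_dom c)) (top_of_set (chart_image c)) (chart_map c)"
  using is_chart by (simp add: is_chart_def)

lemma inj_on_chart: "c \<in> A \<Longrightarrow> inj_on (chart_map c) (chart_dom c)"
  using homeomorphic_imp_injective_map[OF homeomorphic_chart] chart_dom_subset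
  by (simp add: Int_absorb1)

lemma chart_inv_map: "c \<in> A \<Longrightarrow> p \<in> chart_dom c \<Longrightarrow> chart_inv c (chart_map c p) = p"
  by (simp add: chart_inv_def inv_into_f_f[OF inj_on_chart])

lemma open_overlap:
  assumes "c \<in> A" "d \<in> A"
  shows "open (chart_map c ` (chart_dom c \<inter> chart_dom d))"
proof -
  have "openin X (chart_dom d)" using is_chart[OF assms(2)] by (simp add: is_chart_def)
  then have "openin (subtopology X (chart_dom c)) (chart_dom c \<inter> chart_dom d)"
    by (rule openin_subtopology_Int2)
  then have "openin (top_of_set (chart_image c)) (chart_map c ` (chart_dom c \<inter> chart_dom d))"
    using homeomorphic_imp_open_map[OF homeomorphic_chart[OF assms(1)]] by (simp add: open_map_def)
  then show ?thesis
    using is_chart[OF assms(1)] openin_open_eq by (auto simp: is_chart_def)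
qed

lemma immersed_chart: "c \<in> A \<Longrightarrow> immersed_chart (chart_image c) (in_chart f c)"
  using is_chart immersion
  by unfold_locales (auto simp: is_chart_def immersion_def smooth_map_def)

lemma dir_deriv_transition:
  assumes "c \<in> A" "d \<in> A" "p \<in> chart_dom c" "p \<in> chart_dom d"
  shows "dir_deriv (in_chart f c) (chart_map c p) u =
    dir_deriv (in_chart f d) (chart_map d p) (dir_deriv (transition c d) (chart_map c p) u)"
proof -
  let ?W = "chart_map c ` (chart_dom c \<inter> chart_dom d)"
  have W: "open ?W" "chart_map c p \<in> ?W"
    using open_overlap assms by auto
  have eq: "in_chart f c y = in_chart f d (transition c d y)" if "y \<in> ?W" for y
  proof -
    obtain q where "y = chart_map c q" "q \<in> chart_dom c" "q \<in> chart_dom d" using \<open>y \<in> ?W\<close> by blast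
    then show ?thesis by (simp add: transition_def chart_inv_map assms(1,2))
  qed
  have tp: "transition c d (chart_map c p) = chart_map d p"
    using chart_inv_map assms by (simp add: transition_def)
  have "smooth_on ?W (transition c d)"
    using manifold assms(1,2) by (simp add: closed_smooth_manifold_def smooth_atlas_def)
  from smooth_on_has_derivative[OF this W(2)]
  have t: "(transition c d has_derivative dir_deriv (transition c d) (chart_map c p)) (at (chart_map c p))" .
  have "(in_chart f d has_derivative dir_deriv (in_chart f d) (chart_map d p)) (at (transition c d (chart_map c p)))"
    unfolding tp
    using immersed_chart.has_derivative_F[OF immersed_chart[OF assms(2)]] assms(4) by blast
  from dir_deriv_eqI[OF has_derivative_compose[OF t this]]
  show ?thesis
    using dir_deriv_cong[OF W, of "in_chart f c" "\<lambda>y. in_chart f d (transition c d y)"] eq by simp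
qed

lemma range_dir_deriv_eq:
  assumes "c \<in> A" "d \<in> A" "p \<in> chart_dom c" "p \<in> chart_dom d"
  shows "range (dir_deriv (in_chart f c) (chart_map c p)) = range (dir_deriv (in_chart f d) (chart_map d p))"
  using dir_deriv_transition[OF assms] dir_deriv_transition[OF assms(2,1,4,3)]
  by (metis (no_types, lifting) antisym image_subsetI rangeI)

definition radial :: "'a \<Rightarrow> real" where
  "radial p = (let c = SOME c. c \<in> A \<and> p \<in> chart_dom c
     in immersed_chart.radial (in_chart f c) (chart_map c p))"

lemma radial_chart:
  assumes c: "c \<in> A" "p \<in> chart_dom c"
  shows "radial p = immersed_chart.radial (in_chart f c) (chart_map c p)"
proof -
  define d where "d = (SOME c. c \<in> A \<and> p \<in> chart_dom c)"
  have d: "d \<in> A" "p \<in> chart_dom d"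
    using someI[of "\<lambda>c. c \<in> A \<and> p \<in> chart_dom c" c] c by (auto simp: d_def)
  show ?thesis
    unfolding radial_def d_def[symmetric] Let_def
      immersed_chart.radial_def[OF immersed_chart[OF c(1)]]
      immersed_chart.radial_def[OF immersed_chart[OF d(1)]]
      immersed_chart.nor_def[OF immersed_chart[OF c(1)]]
      immersed_chart.nor_def[OF immersed_chart[OF d(1)]]
    using range_dir_deriv_eq[OF c(1) d(1) c(2) d(2)] chart_inv_map c d by simp
qed

lemma continuous_map_radial: "continuous_map X euclideanreal radial"
proof (rule pasting_lemma[where I = A and T = chart_dom
      and f = "\<lambda>c p. immersed_chart.radial (in_chart f c) (chart_map c p)"])
  show "openin X (chart_dom c)" if "c \<in> A" for c
    using is_chart[OF that] by (simp add: is_chart_def)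
  show "continuous_map (subtopology X (chart_dom c)) euclideanreal
      (\<lambda>p. immersed_chart.radial (in_chart f c) (chart_map c p))" if "c \<in> A" for c
  proof -
    have "continuous_map (top_of_set (chart_image c)) euclideanreal (immersed_chart.radial (in_chart f c))"
      using immersed_chart.continuous_on_radial[OF immersed_chart[OF that]] by simp
    from continuous_map_compose[OF homeomorphic_imp_continuous_map[OF homeomorphic_chart[OF that]] this]
    show ?thesis by (simp only: o_def)
  qed
  show "immersed_chart.radial (in_chart f c) (chart_map c p)
      = immersed_chart.radial (in_chart f d) (chart_map d p)"
    if "c \<in> A" "d \<in> A" "p \<in> topspace X \<inter> chart_dom c \<inter> chart_dom d" for c d p
    using that radial_chart[of c p] radial_chart[of d p] by simp
  show "\<exists>c. c \<in> A \<and> p \<in> chart_dom c \<and> radial p = immersed_chart.radial (in_chart f c) (chart_map c p)"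
    if "p \<in> topspace X" for p
    using chart_cover[OF that] radial_chart by blast
qed

lemma radial_attains_max:
  assumes "q \<in> topspace X"
  obtains p where "p \<in> topspace X" "\<And>q. q \<in> topspace X \<Longrightarrow> radial q \<le> radial p"
proof -
  have "compactin X (topspace X)"
    using manifold by (simp add: closed_smooth_manifold_def compact_space_def)
  then have "compact (radial ` topspace X)"
    using image_compactin[OF _ continuous_map_radial] by simp
  then obtain s where "s \<in> radial ` topspace X" "\<And>t. t \<in> radial ` topspace X \<Longrightarrow> t \<le> s"
    using compact_attains_sup[of "radial ` topspace X"] assms by blast
  then show thesis using that by blast
qed

lemma radial_le_1:
  assumes ball: "f ` topspace X \<subseteq> cball 0 1"
    and curv: "\<And>c x w. c \<in> A \<Longrightarrow> x \<in> chart_image c \<Longrightarrow> pullback_metric f c x w w = 1 \<Longrightarrow>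
      (norm (second_fundamental_form f c x w w))\<^sup>2 < 3/2"
    and q: "q \<in> topspace X"
  shows "radial q \<le> 1"
proof -
  obtain p where p: "p \<in> topspace X" "\<And>q. q \<in> topspace X \<Longrightarrow> radial q \<le> radial p"
    using radial_attains_max[OF q] by blast
  obtain c where c: "c \<in> A" "p \<in> chart_dom c" using chart_cover[OF p(1)] by blast
  interpret I: immersed_chart "chart_image c" "in_chart f c" by (rule immersed_chart[OF c(1)])
  have "I.radial (chart_map c p) \<le> 1"
  proof (rule I.radial_maximum)
    show x: "chart_map c p \<in> chart_image c" using c by simp
    show "I.radial y \<le> I.radial (chart_map c p)" if "y \<in> chart_image c" for y
    proof -
      obtain q where "q \<in> chart_dom c" "y = chart_map c q"
        using \<open>y \<in> chart_image c\<close> by blast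
      then show ?thesis
        using p(2)[of q] radial_chart[OF c(1)] c(2) chart_dom_subset[OF c(1)] by auto
    qed
    show "I.sff (chart_map c p) w w \<bullet> I.sff (chart_map c p) w w < 3/2"
      if "I.D (chart_map c p) w \<bullet> I.D (chart_map c p) w = 1" for w
      using curv[OF c(1) x, of w] that
      by (simp add: pullback_metric_def second_fundamental_form_def I.sff_def I.nor_def I.D2_def
          power2_norm_eq_inner)
    show "norm (in_chart f c (chart_map c p)) \<le> 1"
      using ball p(1) c by (auto simp: chart_inv_map)
  qed
  then show ?thesis
    using p(2)[OF q] radial_chart[OF c] by simp
qed

abbreviation potential :: "'a \<Rightarrow> real" where
  "potential p \<equiv> - (3/2) * (f p \<bullet> f p)"

lemma conformal_metric_potential:
  assumes "c \<in> A"
  shows "conformal_metric potential (pullback_metric f) c x = immersed_chart.cmetric (in_chart f c) x"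
  by (simp add: fun_eq_iff conformal_metric_def pullback_metric_def
      immersed_chart.cmetric_def[OF immersed_chart[OF assms]]
      immersed_chart.conf_def[OF immersed_chart[OF assms]])

lemma smooth_map_potential: "smooth_map A potential"
  unfolding smooth_map_def
proof
  fix c assume c: "c \<in> A"
  interpret I: immersed_chart "chart_image c" "in_chart f c" by (rule immersed_chart[OF c])
  have "smooth_on (chart_image c) (\<lambda>x. - (3/2) * (in_chart f c x \<bullet> in_chart f c x))"
    by (intro smooth_on_mult smooth_on_const smooth_on_inner I.smooth_F I.open_S)
  then show "smooth_on (chart_image c) (in_chart potential c)" by (simp add: o_def)
qed

lemma riemannian_metric_potential:
  "riemannian_metric A (conformal_metric potential (pullback_metric f))"
  unfolding riemannian_metric_def
proof (intro conjI ballI allI impI)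
  fix c u v assume c: "c \<in> A"
  interpret I: immersed_chart "chart_image c" "in_chart f c" by (rule immersed_chart[OF c])
  show "smooth_on (chart_image c) (\<lambda>x. conformal_metric potential (pullback_metric f) c x u v)"
    unfolding conformal_metric_potential[OF c] by (rule I.conformal.smooth)
next
  fix c x assume c: "c \<in> A" and x: "x \<in> chart_image c"
  interpret I: immersed_chart "chart_image c" "in_chart f c" by (rule immersed_chart[OF c])
  show "bilinear (conformal_metric potential (pullback_metric f) c x)"
    unfolding conformal_metric_potential[OF c] by (rule I.conformal.bilinear[OF x])
  fix u v
  show "conformal_metric potential (pullback_metric f) c x u v
      = conformal_metric potential (pullback_metric f) c x v u"
    unfolding conformal_metric_potential[OF c] by (rule I.conformal.sym[OF x])
next
  fix c x u assume c: "c \<in> A" and x: "x \<in> chart_image c" and "u \<noteq> (0 :: 'm)"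
  interpret I: immersed_chart "chart_image c" "in_chart f c" by (rule immersed_chart[OF c])
  show "0 < conformal_metric potential (pullback_metric f) c x u u"
    unfolding conformal_metric_potential[OF c] by (rule I.conformal.pos[OF x \<open>u \<noteq> 0\<close>])
next
  fix c d p u v assume "c \<in> A" "d \<in> A" "p \<in> chart_dom c \<inter> chart_dom d"
  then show "conformal_metric potential (pullback_metric f) c (chart_map c p) u v =
     conformal_metric potential (pullback_metric f) d (chart_map d p)
       (dir_deriv (transition c d) (chart_map c p) u) (dir_deriv (transition c d) (chart_map c p) v)"
    using dir_deriv_transition[of c d p]
    by (simp add: conformal_metric_def pullback_metric_def chart_inv_map)
qed

lemma positive_sectional_curvature_potential:
  assumes ball: "f ` topspace X \<subseteq> cball 0 1"
    and curv: "\<And>c x w. c \<in> A \<Longrightarrow> x \<in> chart_image c \<Longrightarrow> pullback_metric f c x w w = 1 \<Longrightarrow>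
      (norm (second_fundamental_form f c x w w))\<^sup>2 < 3/2"
  shows "positive_sectional_curvature A (conformal_metric potential (pullback_metric f))"
  unfolding positive_sectional_curvature_def
proof (intro ballI allI impI)
  fix c x and u v :: 'm assume c: "c \<in> A" and x: "x \<in> chart_image c" and uv: "u \<noteq> v \<and> independent {u, v}"
  interpret I: immersed_chart "chart_image c" "in_chart f c" by (rule immersed_chart[OF c])
  show "0 < sectional_curvature (conformal_metric potential (pullback_metric f)) c x u v"
  proof (rule I.sectional_curvature_cmetric_pos[OF x])
    show "conformal_metric potential (pullback_metric f) c y = I.cmetric y" for y
      by (rule conformal_metric_potential[OF c])
    show "I.sff x w w \<bullet> I.sff x w w < 3/2" if "I.D x w \<bullet> I.D x w = 1" for w
      using curv[OF c x, of w] that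
      by (simp add: pullback_metric_def second_fundamental_form_def I.sff_def I.nor_def I.D2_def
          power2_norm_eq_inner)
    let ?F = "in_chart f c x"
    obtain q where q: "q \<in> chart_dom c" "x = chart_map c q" using x by auto
    have "q \<in> topspace X" using chart_dom_subset[OF c] q(1) by blast
    then have "radial q \<le> 1"
      by (intro radial_le_1 ball curv)
    then have "I.radial x \<le> 1"
      unfolding q(2) radial_chart[OF c q(1)] .
    moreover have "(norm (?F - I.nor x ?F))\<^sup>2 = ?F \<bullet> ?F - I.nor x ?F \<bullet> I.nor x ?F"
      using I.nor_inner_left[OF x, of ?F ?F]
      by (simp add: power2_norm_eq_inner inner_diff_left inner_diff_right inner_commute)
    ultimately show "3 * (?F \<bullet> ?F) - 2 * (I.nor x ?F \<bullet> I.nor x ?F) \<le> 1"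
      by (simp add: I.radial_def power2_norm_eq_inner)
  qed (use uv in auto)
qed

end

theorem proposition2:
  fixes X :: "'a topology"
    and A :: "('a, 'm::euclidean_space) chart set"
    and f :: "'a \<Rightarrow> 'n::euclidean_space"
  assumes "closed_smooth_manifold X A"
    and "immersion A f"
    and "f ` topspace X \<subseteq> cball 0 1"
    and "max_normal_curvature A f < ereal (sqrt (3 / 2))"
  shows "\<exists>\<psi> :: 'a \<Rightarrow> real. smooth_map A \<psi> \<and>
           riemannian_metric A (conformal_metric \<psi> (pullback_metric f)) \<and>
           positive_sectional_curvature A (conformal_metric \<psi> (pullback_metric f))"
proof -
  interpret immersed_manifold X A f
    using assms(1,2) by unfold_locales
  have "(norm (second_fundamental_form f c x w w))\<^sup>2 < 3/2"
    if "c \<in> A" "x \<in> chart_image c" "pullback_metric f c x w w = 1" for c x w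
  proof -
    have "ereal (norm (second_fundamental_form f c x w w)) \<le> max_normal_curvature A f"
      unfolding max_normal_curvature_def
    proof (rule Sup_upper, rule CollectI, intro exI conjI)
      show "sqrt (pullback_metric f c x w w) = 1" using that by simp
    qed (rule refl that)+
    then have "norm (second_fundamental_form f c x w w) < sqrt (3/2)"
      using assms(4) by (metis ereal_less(1) le_less_trans less_ereal.simps(1))
    then have "(norm (second_fundamental_form f c x w w))\<^sup>2 < (sqrt (3/2))\<^sup>2"
      by (intro power_strict_mono) auto
    then show ?thesis by simp
  qed
  then show ?thesis
    using smooth_map_potential riemannian_metric_potential
      positive_sectional_curvature_potential[OF assms(3)] by blast
qed

end
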